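(* Let $\alpha>0$. Put $s:=(2n+1+\alpha)t$, and let $n\to\infty$ and $t\to 0^+$ in such a way that $s$ is finite (fixed). Let $$\Delta(s,\alpha):=\lim_{n\to\infty}\frac{D_n\left(\frac{s}{2n+1+\alpha},\alpha\right)}{D_n(0,\alpha)},\qquad \Delta(0,\alpha)=1,$$ $$C(s):=\lim_{n\to\infty}\frac{y_n\left(\frac{s}{2n+1+\alpha}\right)}{\frac{s}{2n+1+\alpha}}.$$ Then $C$ satisfies $$C''(s)=\frac{(C'(s))^2}{C(s)}-\frac{C'(s)}{s}+\frac{(C(s))^2}{s}+\frac{\alpha}{s^2}-\frac{1}{s^2\,C(s)},$$ with the initial condition $C(0)=1/\alpha$. Moreover, if $$\mathcal{H}(s):=\lim_{n\to\infty}H_n\left(\frac{s}{2n+1+\alpha}\right)=s\frac{d}{ds}\ln\Delta(s,\alpha),$$ then $\mathcal{H}$ satisfies $$(s\mathcal{H}'')^2+4(\mathcal{H}')^2\left(s\mathcal{H}'-\mathcal{H}\right)-\left(\alpha\mathcal{H}'+\frac12\right)^2=0,$$ subject to the initial condition $\mathcal{H}(0)=0$, and $$\mathcal{H}(s)=\frac14\left(\frac{sC'(s)}{C(s)}\right)^2-\frac{sC(s)}{2}-\frac14\left(\frac{1}{C(s)}-\alpha\right)^2.$$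
   Context: For $\alpha>0$, $t\ge 0$, the perturbed Laguerre weight is $w(x;t,\alpha)=x^{\alpha}e^{-x-t/x}$, $x\in\mathbb{R}_+=(0,\infty)$, and the Hankel determinant is $D_n(t,\alpha)=\det\left(\int_0^\infty x^{j+k}w(x;t,\alpha)\,dx\right)_{j,k=0}^{n-1}$. Let $P_n(x)=P_n(x;t,\alpha)$ be the monic polynomials orthogonal with respect to $w(x;t,\alpha)$ on $\mathbb{R}_+$; they satisfy $xP_n(x)=P_{n+1}(x)+\alpha_n(t)P_n(x)+\beta_n(t)P_{n-1}(x)$ with $P_0=1$, $\beta_0P_{-1}=0$. The auxiliary quantity $y_n(t)$ is defined by $\alpha_n(t)=2n+1+\alpha+y_n(t)$. Also $H_n(t):=t\frac{d}{dt}\ln\frac{D_n(t,\alpha)}{D_n(0,\alpha)}$. Primes on $C$ and $\mathcal{H}$ denote $d/ds$. *)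

theory Defs
  imports
    "HOL-Analysis.Analysis"
    "HOL-Computational_Algebra.Polynomial"
    "Jordan_Normal_Form.Determinant"
begin

definition laguerre_weight :: "real \<Rightarrow> real \<Rightarrow> real \<Rightarrow> real" where
  "laguerre_weight t \<alpha> x = x powr \<alpha> * exp (- x - t / x)"

definition hankel_det :: "nat \<Rightarrow> real \<Rightarrow> real \<Rightarrow> real" where
  "hankel_det n t \<alpha> =
     Determinant.det (Matrix.mat n n
       (\<lambda>(j, k). LBINT x:{0<..}. x ^ (j + k) * laguerre_weight t \<alpha> x))"

definition is_monic_orthogonal :: "real \<Rightarrow> real \<Rightarrow> (nat \<Rightarrow> real poly) \<Rightarrow> bool" where
  "is_monic_orthogonal t \<alpha> P \<longleftrightarrow>
     (\<forall>n. Polynomial.degree (P n) = n \<and> lead_coeff (P n) = 1) \<and>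
     (\<forall>m n. m \<noteq> n \<longrightarrow>
        (LBINT x:{0<..}. poly (P m) x * poly (P n) x * laguerre_weight t \<alpha> x) = 0)"

definition orth_poly :: "real \<Rightarrow> real \<Rightarrow> nat \<Rightarrow> real poly" where
  "orth_poly t \<alpha> = (THE P. is_monic_orthogonal t \<alpha> P)"

text \<open>The diagonal coefficient \<open>\<alpha>\<^sub>n(t)\<close> of the three-term recurrence.  The off-diagonal
  coefficient is not determined for \<open>n = 0\<close>, where its term is absent; hence the
  existential quantifier over \<open>b\<close>.\<close>

definition rec_alpha :: "nat \<Rightarrow> real \<Rightarrow> real \<Rightarrow> real" where
  "rec_alpha n t \<alpha> = (THE a. \<exists>b.
     [:0, 1:] * orth_poly t \<alpha> n =
       orth_poly t \<alpha> (Suc n) + Polynomial.smult a (orth_poly t \<alpha> n) +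
       (if n = 0 then 0 else Polynomial.smult b (orth_poly t \<alpha> (n - 1))))"

definition aux_y :: "nat \<Rightarrow> real \<Rightarrow> real \<Rightarrow> real" where
  "aux_y n t \<alpha> = rec_alpha n t \<alpha> - (2 * real n + 1 + \<alpha>)"

text \<open>Only the values for \<open>t \<ge> 0\<close> are meaningful; at \<open>t = 0\<close> the factor \<open>t\<close> makes the value 0
  whatever the (two-sided) derivative is.\<close>

definition log_deriv_H :: "nat \<Rightarrow> real \<Rightarrow> real \<Rightarrow> real" where
  "log_deriv_H n t \<alpha> = t * deriv (\<lambda>u. ln (hankel_det n u \<alpha> / hankel_det n 0 \<alpha>)) t"

definition scaled_t :: "real \<Rightarrow> real \<Rightarrow> nat \<Rightarrow> real" where
  "scaled_t s \<alpha> n = s / (2 * real n + 1 + \<alpha>)"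

definition Delta_lim :: "real \<Rightarrow> real \<Rightarrow> real" where
  "Delta_lim \<alpha> s = lim (\<lambda>n. hankel_det n (scaled_t s \<alpha> n) \<alpha> / hankel_det n 0 \<alpha>)"

text \<open>At \<open>s = 0\<close> the quotient below is \<open>0 / 0\<close>, so the value there is an artefact of division by
  zero; \<open>C(0)\<close> has to be read as the limit of \<open>C(s)\<close> for \<open>s \<rightarrow> 0\<close> from the right.\<close>

definition C_lim :: "real \<Rightarrow> real \<Rightarrow> real" where
  "C_lim \<alpha> s = lim (\<lambda>n. aux_y n (scaled_t s \<alpha> n) \<alpha> / scaled_t s \<alpha> n)"

definition H_lim :: "real \<Rightarrow> real \<Rightarrow> real" where
  "H_lim \<alpha> s = lim (\<lambda>n. log_deriv_H n (scaled_t s \<alpha> n) \<alpha>)"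

end

theory Submission
  imports Defs "HOL-Real_Asymp.Real_Asymp"
begin

text \<open>
  Everything that depends on the weight is a value of the functional
  \<open>L p = \<integral> p w\<close> on Laurent polynomials, and three facts about \<open>L\<close> suffice:
  it is positive, partial integration gives
  \<open>L p' + \<alpha> L (p / x) - L p + t L (p / x\<^sup>2) = 0\<close>, and \<open>d/dt L p = - L (p / x)\<close>.

  \<^bold>\<open>Finite size.\<close> Put \<open>Y\<^sub>n = L (P\<^sub>n\<^sup>2 / x) / L (P\<^sub>n\<^sup>2)\<close> and
  \<open>R\<^sub>n = L (P\<^sub>n P\<^sub>n\<^sub>-\<^sub>1 / x) / L (P\<^sub>n\<^sub>-\<^sub>1\<^sup>2)\<close>.  Partial integration gives \<open>y\<^sub>n = t Y\<^sub>n\<close>, and the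
  off-diagonal recurrence coefficient is eliminated by the two relations
  \<open>quadratic_relation\<close> and \<open>linear_relation\<close>.  What remains is a closed system for \<open>Y\<^sub>n\<close> and \<open>R\<^sub>n\<close>
  in \<open>t\<close>.  With \<open>N = 2n + 1 + \<alpha>\<close>, \<open>t = e\<^sup>x / N\<close> and \<open>u\<^sub>n(x) = ln Y\<^sub>n\<close> it becomes the scalar equation
  \<open>u'' = e\<^sup>x\<^sup>+\<^sup>u + N\<^sup>-\<^sup>2 e\<^sup>2\<^sup>(\<^sup>x\<^sup>+\<^sup>u\<^sup>) + \<alpha> e\<^sup>-\<^sup>u - e\<^sup>-\<^sup>2\<^sup>u\<close>.
  Since \<open>t d/dt ln (L P\<^sub>n\<^sup>2) = - t Y\<^sub>n\<close>, the quantity \<open>H\<^sub>n\<close> is \<open>- t (Y\<^sub>0 + \<dots> + Y\<^sub>n\<^sub>-\<^sub>1)\<close>, which the same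
  relations express in closed form through \<open>u\<^sub>n\<close> and \<open>u\<^sub>n'\<close> (\<open>log_deriv_H_closed_form\<close>).

  \<^bold>\<open>Existence of the limit.\<close> The equation has many solutions with the same value at \<open>s = 0\<close>
  (its linearisation at \<open>C = 1 / \<alpha>\<close> has the exponents \<open>\<plusminus> \<alpha>\<close>, which leaves a multiple of \<open>s\<^sup>\<alpha>\<close> free), so the initial condition
  alone does not single out the limit.  But \<open>\<alpha> Y\<^sub>n \<le> 1\<close> by partial integration, and in this range
  the right-hand side increases with \<open>u\<close> at a rate of at least \<open>\<alpha>\<^sup>2\<close>; it also increases with \<open>N\<^sup>-\<^sup>2\<close>.
  The maximum principle on the whole line (\<open>painleve_rhs_comparison\<close>) therefore shows that \<open>u\<^sub>n(x)\<close>
  increases with \<open>n\<close>; the behaviour required at the two ends is \<open>u\<^sub>n \<rightarrow> - ln \<alpha>\<close> at \<open>- \<infinity>\<close> and the lower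
  bound of order \<open>- x\<close> at \<open>\<infinity>\<close> that follows from the Cauchy-Schwarz inequality.  A bounded
  increasing sequence converges, and dominated convergence carries the derivatives and the equation
  over to the limit (\<open>limit_second_order\<close>).  As \<open>u\<^sub>1 \<le> lim u\<^sub>n \<le> - ln \<alpha>\<close>, the initial value
  \<open>C(0) = 1 / \<alpha>\<close> persists.

  \<^bold>\<open>The remaining claims.\<close> \<open>\<H>\<close> is the limit of the closed form of \<open>H\<^sub>n\<close>; differentiation gives
  \<open>\<H>' = - C / 2\<close>, from which the equation of \<open>\<H>\<close> is an algebraic identity.  Finally
  \<open>ln (D\<^sub>n(t) / D\<^sub>n(0))\<close> is the integral of \<open>H\<^sub>n / s\<close>, which is bounded by \<open>1 / \<alpha>\<close>, so it
  converges to the integral of \<open>\<H> / s\<close>.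
\<close>

section \<open>Orthogonal polynomials of a positive functional\<close>

text \<open>The Gram-Schmidt form shows directly that the coefficients of the orthogonal polynomials are rational
functions of the moments; this is how they inherit differentiability in the parameter of the weight.\<close>

fun gram_schmidt :: "(real poly \<Rightarrow> real) \<Rightarrow> nat \<Rightarrow> real poly" where
  "gram_schmidt l n = Polynomial.monom 1 n -
     (\<Sum>j<n. Polynomial.smult (l (Polynomial.monom 1 n * gram_schmidt l j) /
        l (gram_schmidt l j * gram_schmidt l j)) (gram_schmidt l j))"

declare gram_schmidt.simps [simp del]

lemma gram_schmidt_coeff_ge:
  "i \<ge> n \<Longrightarrow> Polynomial.coeff (gram_schmidt l n) i = (if i = n then 1 else 0)"
proof (induction n arbitrary: i rule: less_induct)
  case (less n)
  have "Polynomial.coeff (\<Sum>j<n. Polynomial.smult (l (Polynomial.monom 1 n * gram_schmidt l j) /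
        l (gram_schmidt l j * gram_schmidt l j)) (gram_schmidt l j)) i = 0"
    using less.prems by (auto simp: Polynomial.coeff_sum less.IH intro!: sum.neutral)
  then show ?case
    by (subst gram_schmidt.simps) (auto simp: Polynomial.coeff_monom)
qed

lemma gram_schmidt_degree: "Polynomial.degree (gram_schmidt l n) = n"
  by (intro antisym Polynomial.degree_le Polynomial.le_degree)
     (auto simp: gram_schmidt_coeff_ge)

lemma gram_schmidt_nonzero: "gram_schmidt l n \<noteq> 0"
  using gram_schmidt_coeff_ge[of n n l] by auto

lemma smult_two: "Polynomial.smult 2 p = p + (p :: real poly)"
  using Polynomial.smult_add_left[of 1 1 p] by simp

text \<open>Only positivity of the functional is used for orthogonality and the three-term recurrence, so these
are independent of the weight.\<close>

locale pos_functional =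
  fixes I0 :: "real poly \<Rightarrow> real"
  assumes I0_add: "I0 (p + q) = I0 p + I0 q"
    and I0_smult: "I0 (Polynomial.smult c p) = c * I0 p"
    and I0_pos: "p \<noteq> 0 \<Longrightarrow> I0 (p * p) > 0"
begin

abbreviation "P \<equiv> gram_schmidt I0"
definition "h n = I0 (P n * P n)"

lemma h_pos: "h n > 0"
  unfolding h_def by (rule I0_pos[OF gram_schmidt_nonzero])

lemma I0_0: "I0 0 = 0"
  using I0_smult[of 0 0] by simp

lemma I0_diff: "I0 (p - q) = I0 p - I0 q"
  using I0_add[of "p - q" q] by simp

lemma I0_sum: "I0 (sum f A) = (\<Sum>x\<in>A. I0 (f x))"
  by (induction A rule: infinite_finite_induct) (auto simp: I0_0 I0_add)

lemma orthogonal_less: "i < n \<Longrightarrow> I0 (P n * P i) = 0"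
proof (induction n arbitrary: i rule: less_induct)
  case (less n)
  have *: "I0 (P j * P i) = (if i = j then h i else 0)" if "j < n" for j
    using less.IH[of j i] less.IH[of i j] that less.prems
    by (cases i j rule: linorder_cases) (auto simp: h_def mult.commute)
  have "I0 (P n * P i) = I0 (Polynomial.monom 1 n * P i) -
     (\<Sum>j<n. I0 (Polynomial.monom 1 n * P j) / h j * I0 (P j * P i))"
    by (subst gram_schmidt.simps)
       (simp add: left_diff_distrib I0_diff sum_distrib_right I0_sum I0_smult h_def)
  also have "(\<Sum>j<n. I0 (Polynomial.monom 1 n * P j) / h j * I0 (P j * P i)) =
     (\<Sum>j<n. if i = j then I0 (Polynomial.monom 1 n * P i) else 0)"
    using * h_pos by (intro sum.cong) (auto simp: less_imp_neq[symmetric])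
  also have "\<dots> = I0 (Polynomial.monom 1 n * P i)"
    using less.prems by simp
  finally show ?case by simp
qed

lemma orthogonal: "i \<noteq> j \<Longrightarrow> I0 (P i * P j) = 0"
  using orthogonal_less[of i j] orthogonal_less[of j i]
  by (cases i j rule: linorder_cases) (auto simp: mult.commute)

text \<open>Subtracting a multiple of \<open>P\<^sub>n\<close> lowers the degree, so the polynomials \<open>P\<^sub>0, \<dots>, P\<^sub>n\<^sub>-\<^sub>1\<close> span everything of degree
less than \<open>n\<close>.  The degree bound is phrased through coefficients to cover the zero polynomial and \<open>n = 0\<close>.\<close>

lemma orthogonal_to_low_degree:
  assumes "\<And>j. j < n \<Longrightarrow> I0 (f * P j) = 0" "\<And>i. i \<ge> n \<Longrightarrow> Polynomial.coeff q i = 0"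
  shows "I0 (f * q) = 0"
  using assms
proof (induction n arbitrary: q)
  case 0
  then have "q = 0" by (simp add: Polynomial.poly_eq_iff)
  then show ?case by (simp add: I0_0)
next
  case (Suc n)
  define q' where "q' = q - Polynomial.smult (Polynomial.coeff q n) (P n)"
  have "I0 (f * q') = 0"
  proof (rule Suc.IH)
    fix i assume "i \<ge> n"
    then show "Polynomial.coeff q' i = 0"
      using Suc.prems(2)[of i] by (cases "i = n") (auto simp: q'_def gram_schmidt_coeff_ge)
  qed (use Suc.prems in auto)
  moreover have "f * q = f * q' + Polynomial.smult (Polynomial.coeff q n) (f * P n)"
    by (simp add: q'_def algebra_simps)
  ultimately show ?case
    using Suc.prems(1)[of n] by (simp add: I0_add I0_smult)
qed

lemma P_orth_low:
  "(\<And>i. i \<ge> n \<Longrightarrow> Polynomial.coeff q i = 0) \<Longrightarrow> I0 (P n * q) = 0"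
  by (rule orthogonal_to_low_degree[of n]) (auto simp: orthogonal)

lemma P_pairing:
  assumes "\<And>i. i > n \<Longrightarrow> Polynomial.coeff q i = 0"
  shows "I0 (P n * q) = Polynomial.coeff q n * h n"
proof -
  define q' where "q' = q - Polynomial.smult (Polynomial.coeff q n) (P n)"
  have "I0 (P n * q') = 0"
  proof (rule P_orth_low)
    fix i assume "i \<ge> n"
    then show "Polynomial.coeff q' i = 0"
      using assms[of i] by (cases "i = n") (auto simp: q'_def gram_schmidt_coeff_ge)
  qed
  moreover have "P n * q = P n * q' + Polynomial.smult (Polynomial.coeff q n) (P n * P n)"
    by (simp add: q'_def algebra_simps)
  ultimately show ?thesis by (simp add: I0_add I0_smult h_def)
qed

text \<open>The difference of two monic candidates has smaller degree and is orthogonal to everything of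
smaller degree, in particular to itself.\<close>

lemma unique_orthogonal:
  assumes "\<And>n. Polynomial.degree (Q n) = n" "\<And>n. Polynomial.lead_coeff (Q n) = 1"
    and "\<And>m n. m \<noteq> n \<Longrightarrow> I0 (Q m * Q n) = 0"
  shows "Q n = P n"
proof (induction n rule: less_induct)
  case (less n)
  define q where "q = Q n - P n"
  have low: "Polynomial.coeff q i = 0" if "i \<ge> n" for i
    using that assms(1,2)[of n]
    by (cases "i = n") (auto simp: q_def gram_schmidt_coeff_ge Polynomial.coeff_eq_0)
  have "I0 (q * q) = 0"
  proof (rule orthogonal_to_low_degree[of n])
    fix j assume j: "j < n"
    have "I0 (Q n * P j) = 0"
      using assms(3)[of n j] less.IH[OF j] j by simp
    then show "I0 (q * P j) = 0"
      using orthogonal[of n j] j by (simp add: q_def left_diff_distrib I0_diff)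
  qed (rule low)
  then have "q = 0" using I0_pos[of q] by fastforce
  then show ?case by (simp add: q_def)
qed

text \<open>The difference of the two sides has degree at most \<open>n\<close> and is orthogonal to \<open>P\<^sub>0, \<dots>, P\<^sub>n\<close>, hence to itself.\<close>

lemma three_term:
  defines "X \<equiv> [:0, 1:]"
  shows "X * P n = P (Suc n) + Polynomial.smult (I0 (X * (P n * P n)) / h n) (P n) +
     (if n = 0 then 0 else Polynomial.smult (h n / h (n - 1)) (P (n - 1)))"
proof -
  define B where "B = (if n = 0 then 0 else Polynomial.smult (h n / h (n - 1)) (P (n - 1)))"
  define q where "q = X * P n - P (Suc n) - Polynomial.smult (I0 (X * (P n * P n)) / h n) (P n) - B"
  have X: "Polynomial.coeff (X * p) i = (if i = 0 then 0 else Polynomial.coeff p (i - 1))" for p i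
    by (simp add: X_def coeff_pCons split: nat.splits)
  have low: "Polynomial.coeff q i = 0" if "i \<ge> Suc n" for i
    using that by (auto simp: q_def X B_def gram_schmidt_coeff_ge)
  have "I0 (q * q) = 0"
  proof (rule orthogonal_to_low_degree[of "Suc n"])
    fix j assume j: "j < Suc n"
    have e: "I0 (q * P j) = I0 (P n * (X * P j)) - I0 (P (Suc n) * P j)
        - I0 (X * (P n * P n)) / h n * I0 (P n * P j) - I0 (B * P j)"
      by (simp add: q_def left_diff_distrib I0_diff I0_smult mult.left_commute mult.assoc)
    have s: "I0 (P (Suc n) * P j) = 0" using j by (intro orthogonal) auto
    consider "j = n" | "Suc j = n" | "Suc j < n" using j by linarith
    then show "I0 (q * P j) = 0"
    proof cases
      case 1
      have "I0 (B * P j) = 0"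
        using 1 orthogonal[of "n - 1" n] by (auto simp: B_def I0_smult I0_0)
      moreover have "I0 (P n * (X * P j)) = I0 (X * (P n * P n))"
        by (simp add: 1 mult.left_commute)
      ultimately show ?thesis
        using e s 1 h_pos[of n] by (simp flip: h_def)
    next
      case 2
      have "I0 (P n * (X * P j)) = h n"
        using 2 by (subst P_pairing) (auto simp: X gram_schmidt_coeff_ge)
      moreover have "I0 (B * P j) = h n"
        using 2 h_pos[of j] by (auto simp: B_def I0_smult simp flip: h_def)
      ultimately show ?thesis
        using e s 2 orthogonal[of n j] by simp
    next
      case 3
      have "I0 (P n * (X * P j)) = 0"
        using 3 by (intro P_orth_low) (auto simp: X gram_schmidt_coeff_ge)
      moreover have "I0 (B * P j) = 0"
        using 3 orthogonal[of "n - 1" j] by (auto simp: B_def I0_smult)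
      ultimately show ?thesis
        using e s 3 orthogonal[of n j] by simp
    qed
  qed (rule low)
  then have "q = 0" using I0_pos[of q] by fastforce
  then show ?thesis by (simp add: q_def B_def algebra_simps)
qed

end

section \<open>Functionals on Laurent polynomials\<close>

text \<open>Here \<open>I0 p\<close>, \<open>I1 p\<close> and \<open>I2 p\<close> stand for the integrals of \<open>p\<close>, \<open>p / x\<close> and \<open>p / x\<^sup>2\<close> against the weight
\<open>x\<^sup>\<alpha> exp (- x - t / x)\<close>.  For \<open>t = 0\<close> the last one may diverge; it then only occurs with the
factor \<open>t\<close>, and its value is left open.\<close>

locale laurent_functional = pos_functional +
  fixes I1 I2 :: "real poly \<Rightarrow> real" and \<alpha> t :: real
  assumes I1_add: "I1 (p + q) = I1 p + I1 q"
    and I1_smult: "I1 (Polynomial.smult c p) = c * I1 p"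
    and I1_pCons: "I1 (pCons 0 p) = I0 p"
    and I2_add: "I2 (p + q) = I2 p + I2 q"
    and I2_smult: "I2 (Polynomial.smult c p) = c * I2 p"
    and I2_pCons: "t \<noteq> 0 \<Longrightarrow> I2 (pCons 0 p) = I1 p"
    and I1_nonneg: "I1 (p * p) \<ge> 0"
    and by_parts: "I0 (pderiv p) + \<alpha> * I1 p - I0 p + t * I2 p = 0"
begin

text \<open>\<open>Y n\<close> is the mean of \<open>1 / x\<close> with respect to the probability density proportional to \<open>P\<^sub>n\<^sup>2 w\<close>, and
\<open>R n\<close> its off-diagonal counterpart; \<open>diag_coeff\<close> is the diagonal coefficient of the three-term recurrence.
The conventions at \<open>n = 0\<close> correspond to \<open>P\<^sub>-\<^sub>1 = 0\<close>.\<close>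

definition "Y n = I1 (P n * P n) / h n"
definition "R n = (if n = 0 then 0 else I1 (P n * P (n - 1)) / h (n - 1))"
definition "subleading_coeff n = (if n = 0 then 0 else Polynomial.coeff (P n) (n - 1))"
definition "diag_coeff n = I0 ([:0, 1:] * (P n * P n)) / h n"

lemma I1_0: "I1 0 = 0"
  using I1_smult[of 0 0] by simp

lemma I1_split: "I1 (P n * pCons a q) = a * I1 (P n) + I0 (P n * q)"
proof -
  have "P n * pCons a q = Polynomial.smult a (P n) + pCons 0 (P n * q)"
    by (simp add: mult_pCons_right)
  then show ?thesis by (simp add: I1_add I1_smult I1_pCons)
qed

text \<open>Christoffel's observation: modulo \<open>x\<close>, the polynomial \<open>q\<close> is its value at \<open>0\<close>, and \<open>P\<^sub>n\<close> is
orthogonal to the quotient.  The pairings with \<open>1 / x\<close> of \<open>P\<^sub>n\<close> and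
polynomials of degree at most \<open>n\<close> thus factor through \<open>I1 (P n)\<close>.\<close>

lemma I1_P:
  assumes "\<And>i. i > n \<Longrightarrow> Polynomial.coeff q i = 0"
  shows "I1 (P n * q) = Polynomial.coeff q 0 * I1 (P n)"
proof (cases q)
  case (pCons a q')
  have "Polynomial.coeff q' i = 0" if "i \<ge> n" for i
    using assms[of "Suc i"] that pCons by simp
  then have "I0 (P n * q') = 0" by (rule P_orth_low)
  then show ?thesis using pCons by (simp add: I1_split del: mult_pCons_right)
qed

lemma pairing_pderiv:
  "I0 ([:0, 1:] * (P n * pderiv (P n))) = real n * h n"
proof -
  have "I0 (P n * ([:0, 1:] * pderiv (P n))) = real n * h n"
    by (subst P_pairing) (auto simp: coeff_pCons coeff_pderiv gram_schmidt_coeff_ge split: nat.splits)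
  then show ?thesis by (simp add: mult.left_commute)
qed

text \<open>Partial integration of \<open>x P\<^sub>n\<^sup>2\<close>.  It identifies the auxiliary quantity \<open>y\<^sub>n\<close> with \<open>t Y\<^sub>n\<close>.\<close>

lemma diag_coeff_eq: "diag_coeff n = 2 * real n + 1 + \<alpha> + t * Y n"
proof -
  let ?X = "[:0, 1:] :: real poly"
  have d: "pderiv (?X * (P n * P n)) = P n * P n + Polynomial.smult 2 (?X * (P n * pderiv (P n)))"
    by (simp add: pderiv_mult pderiv_pCons smult_two algebra_simps)
  have "I0 (pderiv (?X * (P n * P n))) = (2 * real n + 1) * h n"
    unfolding d by (simp only: I0_add I0_smult pairing_pderiv) (simp add: h_def algebra_simps)
  moreover have "I1 (?X * (P n * P n)) = h n"
    by (simp add: I1_pCons h_def)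
  ultimately have "I0 (?X * (P n * P n)) = (2 * real n + 1 + \<alpha>) * h n + t * I1 (P n * P n)"
    using by_parts[of "?X * (P n * P n)"]
    by (cases "t = 0") (simp_all add: I2_pCons algebra_simps)
  then show ?thesis
    using h_pos[of n] by (simp add: diag_coeff_def Y_def field_simps)
qed

lemma diag_coeff_sub: "diag_coeff n = subleading_coeff n - subleading_coeff (Suc n)"
proof -
  have "Polynomial.coeff ([:0, 1:] * P n) n = Polynomial.coeff (P (Suc n) + Polynomial.smult (diag_coeff n) (P n) +
     (if n = 0 then 0 else Polynomial.smult (h n / h (n - 1)) (P (n - 1)))) n"
    using three_term[of n] by (simp add: diag_coeff_def)
  then show ?thesis
    by (cases n) (auto simp: subleading_coeff_def gram_schmidt_coeff_ge)
qed

lemma Y_nonneg: "Y n \<ge> 0"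
  unfolding Y_def using I1_nonneg h_pos[of n] by (auto intro!: divide_nonneg_pos)

text \<open>Partial integration of \<open>P\<^sub>n\<^sup>2\<close>.  As the second summand is nonnegative, it yields \<open>Y\<^sub>n \<le> 1 / \<alpha>\<close>, with equality
at \<open>t = 0\<close>.\<close>

lemma by_parts_square: "\<alpha> * Y n + t * (I2 (P n * P n) / h n) = 1"
proof -
  have "pderiv (P n * P n) = Polynomial.smult 2 (P n * pderiv (P n))"
    by (simp add: pderiv_mult mult.commute smult_two)
  moreover have "I0 (P n * pderiv (P n)) = 0"
    by (rule P_orth_low) (auto simp: coeff_pderiv gram_schmidt_coeff_ge)
  ultimately have "I0 (pderiv (P n * P n)) = 0" by (simp add: I0_smult)
  then show ?thesis
    using by_parts[of "P n * P n"] h_pos[of n] by (simp add: Y_def h_def field_simps)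
qed

text \<open>This is the Cauchy-Schwarz inequality for \<open>x\<^sup>1\<^sup>/\<^sup>2\<close> and \<open>x\<^sup>-\<^sup>1\<^sup>/\<^sup>2\<close> with respect to \<open>P\<^sub>n\<^sup>2 w\<close>; only integral powers of
\<open>x\<close> appear in the functional, so it is derived from the nonnegative quadratic polynomial
\<open>c \<mapsto> I1 (((x - c) P\<^sub>n)\<^sup>2)\<close>.\<close>

lemma one_le_diag_coeff_Y: "1 \<le> diag_coeff n * Y n"
proof -
  define a y where "a = diag_coeff n" and "y = Y n"
  have key: "0 \<le> a - 2 * c + c\<^sup>2 * y" for c
  proof -
    let ?q = "[:-c, 1:] * P n"
    have "?q * ?q = [:0,1:] * ([:0,1:] * (P n * P n)) +
        (Polynomial.smult (-c) ([:0,1:] * (P n * P n)) + (Polynomial.smult (-c) ([:0,1:] * (P n * P n)) + Polynomial.smult (c\<^sup>2) (P n * P n)))"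
      by (simp add: algebra_simps power2_eq_square)
    then have "I1 (?q * ?q) = I0 ([:0,1:] * (P n * P n)) - 2 * c * h n + c\<^sup>2 * I1 (P n * P n)"
      by (simp only: I1_add I1_smult) (simp add: I1_pCons h_def)
    then have "I1 (?q * ?q) / h n = a - 2 * c + c\<^sup>2 * y"
      using h_pos[of n] by (simp add: a_def y_def diag_coeff_def Y_def field_simps)
    then show ?thesis using I1_nonneg[of ?q] h_pos[of n] by (metis divide_nonneg_pos)
  qed
  have "y \<noteq> 0"
  proof
    assume "y = 0"
    with key[of "a + 1"] key[of "(a + 1) / 2"] show False by (simp add: field_simps)
  qed
  then have y: "y > 0" using Y_nonneg[of n] by (simp add: y_def)
  have "0 \<le> a - 2 * (1 / y) + (1 / y)\<^sup>2 * y" by (rule key)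
  then have "1 / y \<le> a" using y by (simp add: power2_eq_square field_simps)
  then show ?thesis using y by (simp add: a_def y_def field_simps)
qed

lemma Y_pos: "Y n > 0"
  using one_le_diag_coeff_Y[of n] Y_nonneg[of n] by (cases "Y n = 0") auto

lemma R_sum: "R n + R (Suc n) + diag_coeff n * Y n = 1"
proof -
  let ?X = "[:0, 1:] :: real poly"
  have "h n = I1 (?X * P n * P n)"
    by (simp add: I1_pCons h_def)
  also have "\<dots> = I1 (P (Suc n) * P n) + diag_coeff n * I1 (P n * P n) +
      (if n = 0 then 0 else h n / h (n - 1) * I1 (P n * P (n - 1)))"
    by (subst three_term[of n, folded diag_coeff_def])
       (simp add: distrib_left distrib_right I1_0 I1_add I1_smult mult.commute)
  finally show ?thesis
    using h_pos[of n] h_pos[of "n - 1"] by (auto simp: R_def Y_def field_simps)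
qed

lemma I2_P:
  assumes "t \<noteq> 0" "\<And>i. i > Suc n \<Longrightarrow> Polynomial.coeff q i = 0"
  shows "I2 (P n * q) = Polynomial.coeff q 0 * I2 (P n) + Polynomial.coeff q 1 * I1 (P n)"
proof (cases q)
  case (pCons a q')
  have "Polynomial.coeff q' i = 0" if "i > n" for i
    using assms(2)[of "Suc i"] that pCons by simp
  then have *: "I1 (P n * q') = Polynomial.coeff q' 0 * I1 (P n)" by (rule I1_P)
  have "P n * q = Polynomial.smult a (P n) + pCons 0 (P n * q')"
    by (simp add: pCons mult_pCons_right)
  then have "I2 (P n * q) = a * I2 (P n) + I1 (P n * q')"
    by (simp add: I2_add I2_smult I2_pCons[OF assms(1)])
  with * show ?thesis by (simp add: pCons)
qed

context
  fixes m n assumes n: "n = Suc m"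
begin

text \<open>Evaluating the pairing of two neighbours from either side; the two values differ by a squared norm
because the larger index exceeds the degree allowed in \<open>I1_P\<close> by one.\<close>

lemma I1_adjacent:
  "I1 (P n * P m) = Polynomial.coeff (P m) 0 * I1 (P n)"
  "I1 (P n * P m) = Polynomial.coeff (P n) 0 * I1 (P m) + h m"
proof -
  show "I1 (P n * P m) = Polynomial.coeff (P m) 0 * I1 (P n)"
    by (rule I1_P) (auto simp: n gram_schmidt_coeff_ge)
  obtain a q where q: "P n = pCons a q" by (cases "P n")
  have c: "Polynomial.coeff q i = Polynomial.coeff (P n) (Suc i)" for i by (simp add: q)
  have "I0 (P m * q) = h m"
    by (subst P_pairing) (auto simp: c n gram_schmidt_coeff_ge)
  then show "I1 (P n * P m) = Polynomial.coeff (P n) 0 * I1 (P m) + h m"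
    by (subst mult.commute) (simp add: q I1_split del: mult_pCons_right)
qed

lemma quadratic_relation: "h n / h m * Y n * Y m = (R n)\<^sup>2 - R n"
proof -
  have "I1 (P n * P n) * I1 (P m * P m) = I1 (P n * P m) * (I1 (P n * P m) - h m)"
    by (subst (1 2) I1_P) (auto simp: gram_schmidt_coeff_ge I1_adjacent(2), simp add: I1_adjacent(1)[unfolded I1_adjacent(2)])
  then show ?thesis
    using h_pos[of n] h_pos[of m] by (simp add: R_def Y_def n field_simps power2_eq_square)
qed

lemma by_parts_adjacent: "real n * h m + \<alpha> * I1 (P n * P m) + t * I2 (P n * P m) = 0"
proof -
  have "I0 (P m * pderiv (P n)) = real n * h m"
    by (subst P_pairing) (auto simp: coeff_pderiv n gram_schmidt_coeff_ge)
  moreover have "I0 (P n * pderiv (P m)) = 0"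
    by (rule P_orth_low) (auto simp: coeff_pderiv n gram_schmidt_coeff_ge)
  ultimately have "I0 (pderiv (P n * P m)) = real n * h m"
    by (simp add: pderiv_mult I0_add)
  then show ?thesis
    using by_parts[of "P n * P m"] orthogonal[of n m] by (simp add: n)
qed

text \<open>Partial integration of \<open>x P\<^sub>n P\<^sub>n\<^sub>-\<^sub>1\<close>: the leading terms of \<open>x P\<^sub>n'\<close> and \<open>n P\<^sub>n\<close> cancel, which leaves the
subleading coefficient.\<close>

lemma subleading_coeff_eq: "subleading_coeff n = t * R n - h n / h m"
proof -
  let ?X = "[:0, 1:] :: real poly"
  have X: "Polynomial.coeff (?X * p) i = (if i = 0 then 0 else Polynomial.coeff p (i - 1))" for p i
    by (simp add: coeff_pCons split: nat.splits)
  define q where "q = ?X * pderiv (P n) - Polynomial.smult (real n) (P n)"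
  have c: "Polynomial.coeff q i = (real i - real n) * Polynomial.coeff (P n) i" for i
    by (cases i) (auto simp: q_def coeff_pderiv algebra_simps)
  have "I0 (P m * q) = - subleading_coeff n * h m"
    by (subst P_pairing) (auto simp: c n gram_schmidt_coeff_ge subleading_coeff_def)
  moreover have "?X * pderiv (P n) * P m = P m * q + Polynomial.smult (real n) (P n * P m)"
    by (simp add: q_def algebra_simps del: mult_pCons_left mult_pCons_right)
  ultimately have 1: "I0 (?X * pderiv (P n) * P m) = - subleading_coeff n * h m"
    using orthogonal[of n m] n by (simp add: I0_add I0_smult del: mult_pCons_left mult_pCons_right)
  have 2: "I0 (P n * (?X * pderiv (P m))) = 0"
    by (rule P_orth_low) (auto simp: X coeff_pderiv n gram_schmidt_coeff_ge simp del: mult_pCons_left)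
  have 3: "I0 (P n * (?X * P m)) = h n"
    by (subst P_pairing) (auto simp: X n gram_schmidt_coeff_ge simp del: mult_pCons_left)
  have 4: "I0 (P n * P m) = 0" using orthogonal[of n m] n by simp
  have "pderiv (?X * (P n * P m)) = P n * P m + (?X * pderiv (P n) * P m + P n * (?X * pderiv (P m)))"
    by (simp add: pderiv_mult pderiv_pCons algebra_simps del: mult_pCons_left mult_pCons_right)
  then have "I0 (pderiv (?X * (P n * P m))) = - subleading_coeff n * h m"
    by (simp only: I0_add 1 2 4)
  moreover have "I1 (?X * (P n * P m)) = 0" by (simp add: I1_pCons 4)
  moreover have "I0 (?X * (P n * P m)) = h n" using 3 by (simp only: mult.left_commute)
  ultimately have "- subleading_coeff n * h m - h n + t * I1 (P n * P m) = 0"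
    using by_parts[of "?X * (P n * P m)"]
    by (cases "t = 0") (simp_all add: I2_pCons 4)
  then show ?thesis
    using h_pos[of m] by (simp add: R_def n field_simps)
qed

text \<open>The pairings of two neighbours with \<open>1 / x\<^sup>2\<close> factor through the values and slopes of the polynomials at \<open>0\<close>
and the numbers \<open>I1 (P n)\<close>, \<open>I2 (P n)\<close>.  The mixed pairing can be written in two ways, and eliminating
values and slopes leaves an identity between pairings; partial integration then turns each pairing with
\<open>1 / x\<^sup>2\<close> into one with \<open>1 / x\<close>.\<close>

lemma linear_relation:
  assumes "t \<noteq> 0"
  shows "h n / h m * (Y n + Y m) = real n - (2 * real n + \<alpha>) * R n"
proof -
  define p p1 q q1 where "p = Polynomial.coeff (P n) 0" and "p1 = Polynomial.coeff (P n) 1"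
    and "q = Polynomial.coeff (P m) 0" and "q1 = Polynomial.coeff (P m) 1"
  define A A' B B' where "A = I1 (P n)" and "A' = I1 (P m)" and "B = I2 (P n)" and "B' = I2 (P m)"
  define J V V' where "J = I2 (P n * P m)" and "V = I2 (P n * P n)" and "V' = I2 (P m * P m)"
  have w: "q * A = p * A' + h m"
    using I1_adjacent by (simp add: p_def q_def A_def A'_def)
  have I1s: "I1 (P n * P m) = q * A" "I1 (P n * P n) = p * A" "I1 (P m * P m) = q * A'"
    by (auto simp: p_def q_def A_def A'_def I1_adjacent(1) gram_schmidt_coeff_ge intro!: I1_P)
  have J1: "J = q * B + q1 * A" unfolding J_def q_def q1_def B_def A_def
    by (rule I2_P[OF assms]) (auto simp: n gram_schmidt_coeff_ge)
  have J2: "J = p * B' + p1 * A'" unfolding J_def p_def p1_def B'_def A'_def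
    by (subst mult.commute, rule I2_P[OF assms]) (auto simp: n gram_schmidt_coeff_ge)
  have V: "V = p * B + p1 * A" unfolding V_def p_def p1_def B_def A_def
    by (rule I2_P[OF assms]) (auto simp: gram_schmidt_coeff_ge)
  have V': "V' = q * B' + q1 * A'" unfolding V'_def q_def q1_def B'_def A'_def
    by (rule I2_P[OF assms]) (auto simp: gram_schmidt_coeff_ge)
  have e1: "h n = \<alpha> * (p * A) + t * V"
    using by_parts_square[of n] h_pos[of n] by (simp add: Y_def I1s V_def field_simps)
  have e2: "h m = \<alpha> * (q * A') + t * V'"
    using by_parts_square[of m] h_pos[of m] by (simp add: Y_def I1s V'_def field_simps)
  have e3: "t * J = - real n * h m - \<alpha> * (q * A)"
    using by_parts_adjacent by (simp add: I1s J_def)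
  have "h m * (p * A) + h n * (q * A') =
      2 * \<alpha> * (q * A) * (p * A') + t * (V' * (p * A) + V * (q * A'))"
    unfolding e1 e2 by (simp add: algebra_simps)
  also have "V' * (p * A) + V * (q * A') = (q * A) * (p * B' + p1 * A') + (p * A') * (q * B + q1 * A)"
    by (simp add: V V' algebra_simps)
  also have "\<dots> = J * (q * A + p * A')"
    unfolding J1[symmetric] J2[symmetric] by (simp add: algebra_simps)
  also have "p * A' = q * A - h m" using w by simp
  also have "t * (J * (q * A + (q * A - h m))) = (- real n * h m - \<alpha> * (q * A)) * (2 * (q * A) - h m)"
    unfolding e3[symmetric] by (simp add: algebra_simps)
  finally have "h m * (p * A) + h n * (q * A') = real n * h m * h m - (2 * real n + \<alpha>) * (q * A) * h m"
    by (simp add: algebra_simps)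
  note fin = this
  have Rn: "R n = q * A / h m" using I1s(1) by (simp add: R_def n)
  have Yn: "Y n = p * A / h n" and Ym: "Y m = q * A' / h m" by (simp_all add: Y_def I1s)
  have "h n / h m * (Y n + Y m) = (h m * (p * A) + h n * (q * A')) / (h m * h m)"
    unfolding Yn Ym using h_pos[of n] h_pos[of m] by (simp add: field_simps)
  also have "\<dots> = real n - (2 * real n + \<alpha>) * R n"
    unfolding fin Rn using h_pos[of m] by (simp add: field_simps)
  finally show ?thesis .
qed

end

end

section \<open>The perturbed Laguerre weight\<close>

definition laguerre_int :: "nat \<Rightarrow> real \<Rightarrow> real \<Rightarrow> real poly \<Rightarrow> real" where
  "laguerre_int k \<alpha> t p = (LBINT x:{0<..}. poly p x / x ^ k * laguerre_weight t \<alpha> x)"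

lemma laguerre_weight_measurable [measurable]: "laguerre_weight t \<alpha> \<in> borel_measurable borel"
  unfolding laguerre_weight_def by measurable

lemma poly_measurable [measurable]: "poly (p :: real poly) \<in> borel_measurable borel"
  by (intro borel_measurable_continuous_onI continuous_intros)

lemma gamma_integrable:
  assumes "a > (0::real)"
  shows "set_integrable lborel {0<..} (\<lambda>x. x powr (a - 1) * exp (- x))"
proof -
  have "integrable lborel (\<lambda>x. indicator {0..} x * x powr (a - 1) / exp x)"
  proof (rule integrableI_nonneg)
    show "(\<integral>\<^sup>+ x. ennreal (indicator {0..} x * x powr (a - 1) / exp x) \<partial>lborel) < \<infinity>"
      by (subst Gamma_conv_nn_integral_real[OF assms, symmetric]) simp
  qed auto
  then have "set_integrable lborel {0..} (\<lambda>x. x powr (a - 1) * exp (- x))"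
    by (simp add: set_integrable_def exp_minus field_simps)
  then show ?thesis by (rule set_integrable_subset) auto
qed

text \<open>This is where \<open>\<alpha> > 0\<close> matters: the unperturbed weight still integrates \<open>1 / x\<close>.  Since the weight decreases
in \<open>t\<close>, these functions dominate the integrands with \<open>p\<close> and \<open>p / x\<close> uniformly in \<open>t \<ge> 0\<close>.\<close>

lemma integrable_dominating:
  assumes "\<alpha> > 0"
  shows "set_integrable lborel {0<..} (\<lambda>x. poly p x / x * laguerre_weight 0 \<alpha> x)"
  using assms
proof (induction p arbitrary: \<alpha>)
  case 0
  then show ?case by (simp add: set_integrable_def)
next
  case (pCons a p)
  have "set_integrable lborel {0<..} (\<lambda>x. a * (x powr (\<alpha> - 1) * exp (- x)) +
          poly p x / x * laguerre_weight 0 (\<alpha> + 1) x)"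
    using pCons.prems by (intro set_integral_add set_integrable_mult_right gamma_integrable pCons.IH) auto
  also have "?this \<longleftrightarrow> ?case"
    by (intro set_integrable_cong)
       (auto simp: laguerre_weight_def powr_add powr_diff field_simps)
  finally show ?case .
qed

lemma laguerre_weight_le: "x > 0 \<Longrightarrow> t \<ge> 0 \<Longrightarrow> laguerre_weight t \<alpha> x \<le> laguerre_weight 0 \<alpha> x"
  unfolding laguerre_weight_def by (intro mult_left_mono) auto

lemma laguerre_weight_pos: "x > 0 \<Longrightarrow> laguerre_weight t \<alpha> x > 0"
  unfolding laguerre_weight_def by simp

lemma weighted_abs_le:
  assumes "x > 0" "t \<ge> 0"
  shows "\<bar>c * laguerre_weight t \<alpha> x\<bar> \<le> \<bar>c * laguerre_weight 0 \<alpha> x\<bar>"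
  unfolding abs_mult using laguerre_weight_le[OF assms] laguerre_weight_pos[OF assms(1)]
  by (intro mult_left_mono) (auto simp: less_imp_le)

text \<open>For \<open>t > 0\<close> the factor \<open>exp (- t / x)\<close> absorbs one more power of \<open>1 / x\<close>, since \<open>z exp (- z) \<le> 1\<close>.\<close>

lemma inverse_weight_le:
  assumes "x > 0" "t > 0"
  shows "laguerre_weight t \<alpha> x / x \<le> laguerre_weight 0 \<alpha> x / t"
proof -
  have "t / x \<le> exp (t / x)" using exp_ge_add_one_self[of "t / x"] by linarith
  then have "t / x * exp (- (t / x)) \<le> 1" using assms by (simp add: exp_minus field_simps)
  then have "x powr \<alpha> * exp (- x) / t * (t / x * exp (- (t / x))) \<le> x powr \<alpha> * exp (- x) / t * 1"
    using assms by (intro mult_left_mono) auto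
  moreover have "exp (- x - t / x) = exp (- x) * exp (- (t / x))"
    by (simp flip: exp_add)
  ultimately show ?thesis
    using assms by (simp add: laguerre_weight_def)
qed

lemma laguerre_integrable:
  assumes "\<alpha> > 0" "t \<ge> 0" "k \<le> 1 \<or> k = 2 \<and> t > 0"
  shows "set_integrable lborel {0<..} (\<lambda>x. poly p x / x ^ k * laguerre_weight t \<alpha> x)"
proof -
  have meas: "set_borel_measurable lborel {0<..} (\<lambda>x. poly p x / x ^ k * laguerre_weight t \<alpha> x)"
    unfolding set_borel_measurable_def by measurable
  consider "k = 0" | "k = 1" | "k = 2" "t > 0" using assms(3) by fastforce
  then show ?thesis
  proof cases
    case 1
    show ?thesis
      by (rule set_integrable_bound[OF integrable_dominating[OF assms(1), of "pCons 0 p"] meas])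
         (use assms laguerre_weight_le laguerre_weight_pos in \<open>auto simp: 1 abs_mult less_imp_le intro!: mult_left_mono\<close>)
  next
    case 2
    show ?thesis
      using weighted_abs_le[OF _ assms(2), of _ "poly p _ / _" \<alpha>]
      by (intro set_integrable_bound[OF integrable_dominating[OF assms(1), of p] meas])
         (auto simp: 2 simp del: times_divide_eq_left)
  next
    case 3
    have "norm (poly p x / x ^ k * laguerre_weight t \<alpha> x)
        \<le> norm (poly (Polynomial.smult (1 / t) p) x / x * laguerre_weight 0 \<alpha> x)" if "x > 0" for x
    proof -
      have "\<bar>poly p x\<bar> / x * (laguerre_weight t \<alpha> x / x) \<le> \<bar>poly p x\<bar> / x * (laguerre_weight 0 \<alpha> x / t)"
        using that 3 by (intro mult_left_mono inverse_weight_le) auto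
      then show ?thesis
        using that 3 laguerre_weight_pos[OF that, of t \<alpha>] laguerre_weight_pos[OF that, of 0 \<alpha>]
        by (simp add: abs_mult power2_eq_square field_simps)
    qed
    then show ?thesis
      by (intro set_integrable_bound[OF integrable_dominating[OF assms(1), of "Polynomial.smult (1 / t) p"] meas]) auto
  qed
qed

lemma laguerre_int_add:
  assumes "\<alpha> > 0" "t \<ge> 0" "k \<le> 1 \<or> k = 2 \<and> t > 0"
  shows "laguerre_int k \<alpha> t (p + q) = laguerre_int k \<alpha> t p + laguerre_int k \<alpha> t q"
  unfolding laguerre_int_def
  by (subst set_integral_add(2)[OF laguerre_integrable[OF assms] laguerre_integrable[OF assms], symmetric])
     (simp add: add_divide_distrib distrib_right)

lemma laguerre_int_smult:
  "laguerre_int k \<alpha> t (Polynomial.smult c p) = c * laguerre_int k \<alpha> t p"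
  unfolding laguerre_int_def
  by (subst set_integral_mult_right[symmetric]) (simp add: mult.assoc)

lemma laguerre_int_pCons: "laguerre_int (Suc k) \<alpha> t (pCons 0 p) = laguerre_int k \<alpha> t p"
  unfolding laguerre_int_def by (intro set_lebesgue_integral_cong) auto

lemma laguerre_int_square_nonneg: "laguerre_int k \<alpha> t (p * p) \<ge> 0"
  unfolding laguerre_int_def set_lebesgue_integral_def
  by (intro integral_nonneg_AE) (auto simp: indicator_def less_imp_le[OF laguerre_weight_pos])

text \<open>A vanishing integral would force \<open>p\<close> to vanish almost everywhere on the half-line, but its roots
form a null set.\<close>

lemma laguerre_int_square_pos:
  assumes "\<alpha> > 0" "t \<ge> 0" "p \<noteq> 0"
  shows "laguerre_int 0 \<alpha> t (p * p) > 0"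
proof (rule ccontr)
  assume "\<not> ?thesis"
  then have "laguerre_int 0 \<alpha> t (p * p) = 0"
    using laguerre_int_square_nonneg[of 0 \<alpha> t p] by linarith
  then have "AE x in lborel. indicator {0<..} x *\<^sub>R (poly (p * p) x / x ^ 0 * laguerre_weight t \<alpha> x) = 0"
    using laguerre_integrable[OF assms(1,2), of 0 "p * p"]
    unfolding laguerre_int_def set_lebesgue_integral_def set_integrable_def
    by (subst (asm) integral_nonneg_eq_0_iff_AE)
       (auto simp: indicator_def less_imp_le[OF laguerre_weight_pos])
  moreover have "AE x in lborel. x \<notin> {x. poly p x = 0}"
    using poly_roots_finite[OF assms(3)] by (intro AE_not_in finite_imp_null_set_lborel)
  ultimately have "AE x in lborel. x \<notin> {0<..<1::real}"
    by eventually_elim (auto simp: indicator_def less_imp_neq[OF laguerre_weight_pos, symmetric] split: if_splits)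
  then have "emeasure lborel {0<..<1::real} = 0"
    by (subst (asm) AE_iff_measurable[of "{0<..<1}"]) auto
  then show False by simp
qed

lemma weight_has_derivative:
  assumes "x > 0"
  shows "((\<lambda>x. poly p x * laguerre_weight t \<alpha> x) has_real_derivative
    poly (pderiv p) x * laguerre_weight t \<alpha> x + \<alpha> * (poly p x / x * laguerre_weight t \<alpha> x)
    - poly p x * laguerre_weight t \<alpha> x + t * (poly p x / x\<^sup>2 * laguerre_weight t \<alpha> x)) (at x)"
proof -
  have "((\<lambda>x. exp (- x - t / x)) has_real_derivative exp (- x - t / x) * (- 1 + t / x\<^sup>2)) (at x)"
    using assms by (auto intro!: derivative_eq_intros simp: power2_eq_square)
  moreover have "((\<lambda>x. x powr \<alpha>) has_real_derivative \<alpha> * (x powr \<alpha> / x)) (at x)"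
    using assms by (auto intro!: derivative_eq_intros simp: powr_diff)
  ultimately have "((\<lambda>x. poly p x * (x powr \<alpha> * exp (- x - t / x))) has_real_derivative
      poly (pderiv p) x * (x powr \<alpha> * exp (- x - t / x)) +
      (\<alpha> * (x powr \<alpha> / x) * exp (- x - t / x) + exp (- x - t / x) * (- 1 + t / x\<^sup>2) * x powr \<alpha>) * poly p x) (at x)"
    by (intro DERIV_mult poly_DERIV)
  then show ?thesis
    unfolding laguerre_weight_def by (rule DERIV_cong) (simp add: algebra_simps)
qed

lemma weighted_poly_at_top: "((\<lambda>x. poly p x * (x powr \<alpha> * exp (- x))) \<longlongrightarrow> 0) (at_top :: real filter)"
proof (induction p arbitrary: \<alpha>)
  case (pCons a p)
  have "((\<lambda>x::real. x powr \<alpha> * exp (- x)) \<longlongrightarrow> 0) at_top" by real_asymp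
  then have "((\<lambda>x. a * (x powr \<alpha> * exp (- x)) + poly p x * (x powr (\<alpha> + 1) * exp (- x))) \<longlongrightarrow> a * 0 + 0) at_top"
    by (intro tendsto_intros pCons.IH)
  moreover have "\<forall>\<^sub>F x in at_top. a * (x powr \<alpha> * exp (- x)) + poly p x * (x powr (\<alpha> + 1) * exp (- x))
      = poly (pCons a p) x * (x powr \<alpha> * exp (- x))"
    using eventually_gt_at_top[of 0] by eventually_elim (simp add: powr_add algebra_simps)
  ultimately show ?case by (simp add: tendsto_cong)
qed simp

text \<open>The fundamental theorem of calculus for \<open>p w\<close>, whose boundary values vanish: at \<open>0\<close> because of
\<open>x\<^sup>\<alpha>\<close>, at infinity because of \<open>exp (- x)\<close>.\<close>

lemma laguerre_by_parts:
  assumes "\<alpha> > 0" "t \<ge> 0"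
  shows "laguerre_int 0 \<alpha> t (pderiv p) + \<alpha> * laguerre_int 1 \<alpha> t p - laguerre_int 0 \<alpha> t p
     + t * (if t = 0 then 0 else laguerre_int 2 \<alpha> t p) = 0"
proof -
  define F where "F = (\<lambda>x. poly p x * laguerre_weight t \<alpha> x)"
  define f1 f2 f3 f4 where "f1 = (\<lambda>x. poly (pderiv p) x * laguerre_weight t \<alpha> x)"
    and "f2 = (\<lambda>x. \<alpha> * (poly p x / x * laguerre_weight t \<alpha> x))"
    and "f3 = (\<lambda>x. poly p x * laguerre_weight t \<alpha> x)"
    and "f4 = (\<lambda>x. t * (poly p x / x\<^sup>2 * laguerre_weight t \<alpha> x))"
  note f_defs = f1_def f2_def f3_def f4_def
  define f where "f = (\<lambda>x. f1 x + f2 x - f3 x + f4 x)"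
  have int: "set_integrable lborel {0<..} f1" "set_integrable lborel {0<..} f3"
    using laguerre_integrable[OF assms, of 0 p] laguerre_integrable[OF assms, of 0 "pderiv p"]
    by (simp_all add: f_defs)
  have int2: "set_integrable lborel {0<..} f2"
    unfolding f2_def using laguerre_integrable[OF assms, of 1 p]
    by (intro set_integrable_mult_right) simp
  have int4: "set_integrable lborel {0<..} f4"
    unfolding f4_def
    by (rule set_integrable_mult_right, rule laguerre_integrable) (use assms in auto)
  have F_le: "\<bar>F x\<bar> \<le> \<bar>poly p x * (x powr \<alpha> * exp (- x))\<bar>" if "x > 0" for x
    using laguerre_weight_le[OF that assms(2), of \<alpha>] laguerre_weight_pos[OF that, of t \<alpha>]
    unfolding F_def abs_mult by (intro mult_left_mono) (auto simp: laguerre_weight_def)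
  have "(LBINT x=ereal 0..\<infinity>. f x) = 0 - 0"
  proof (rule interval_integral_FTC_integrable)
    fix x assume "ereal 0 < ereal x"
    then have x: "x > 0" by simp
    show "(F has_vector_derivative f x) (at x)"
      using weight_has_derivative[OF x, of p t \<alpha>]
      by (simp add: F_def f_def f_defs has_real_derivative_iff_has_vector_derivative)
    show "isCont f x"
      unfolding f_def f_defs laguerre_weight_def using x by (auto intro!: continuous_intros)
  next
    show "set_integrable lborel (einterval (ereal 0) \<infinity>) f"
      unfolding f_def using int int2 int4
      by (auto simp: einterval_eq intro!: set_integral_add set_integral_diff)
  next
    have "((\<lambda>x. poly p x * (x powr \<alpha> * exp (- x))) \<longlongrightarrow> poly p 0 * (0 * exp (- 0))) (at_right 0)"
    proof (intro tendsto_intros)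
      show "((\<lambda>x. x powr \<alpha>) \<longlongrightarrow> 0) (at_right 0)"
        using assms(1) by real_asymp
    qed
    then have "((\<lambda>x. \<bar>poly p x * (x powr \<alpha> * exp (- x))\<bar>) \<longlongrightarrow> 0) (at_right 0)"
      by (simp add: tendsto_rabs_zero)
    then have "(F \<longlongrightarrow> 0) (at_right 0)"
      by (rule Lim_null_comparison[rotated])
         (use F_le in \<open>auto simp: eventually_at_filter\<close>)
    then show "((F \<circ> real_of_ereal) \<longlongrightarrow> 0) (at_right (ereal 0))"
      by (simp add: ereal_tendsto_simps)
    have "((\<lambda>x. \<bar>poly p x * (x powr \<alpha> * exp (- x))\<bar>) \<longlongrightarrow> 0) at_top"
      using weighted_poly_at_top by (rule tendsto_rabs_zero)
    moreover have "\<forall>\<^sub>F x in at_top. norm (F x) \<le> \<bar>poly p x * (x powr \<alpha> * exp (- x))\<bar>"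
      using eventually_gt_at_top[of 0] by eventually_elim (use F_le in auto)
    ultimately have "(F \<longlongrightarrow> 0) at_top"
      by (rule Lim_null_comparison[rotated])
    then show "((F \<circ> real_of_ereal) \<longlongrightarrow> 0) (at_left \<infinity>)"
      by (simp add: ereal_tendsto_simps)
  qed auto
  then have "(LBINT x:{0<..}. f x) = 0"
    by (simp add: interval_integral_to_infinity_eq)
  moreover have "(LBINT x:{0<..}. f x) =
      (LBINT x:{0<..}. f1 x) + (LBINT x:{0<..}. f2 x) - (LBINT x:{0<..}. f3 x) + (LBINT x:{0<..}. f4 x)"
    unfolding f_def using int int2 int4
    by (simp add: set_integral_add set_integral_diff)
  moreover have "(LBINT x:{0<..}. f1 x) = laguerre_int 0 \<alpha> t (pderiv p)"
    "(LBINT x:{0<..}. f3 x) = laguerre_int 0 \<alpha> t p"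
    by (simp_all add: f_defs laguerre_int_def)
  moreover have "(LBINT x:{0<..}. f2 x) = \<alpha> * laguerre_int 1 \<alpha> t p"
    unfolding f2_def by (subst set_integral_mult_right) (simp add: laguerre_int_def)
  moreover have "(LBINT x:{0<..}. f4 x) = t * (if t = 0 then 0 else laguerre_int 2 \<alpha> t p)"
    unfolding f4_def by (subst set_integral_mult_right) (simp add: laguerre_int_def)
  ultimately show ?thesis by (simp only:)
qed

lemma laguerre_functional:
  assumes "\<alpha> > 0" "t \<ge> 0"
  shows "laurent_functional (laguerre_int 0 \<alpha> t) (laguerre_int 1 \<alpha> t)
    (if t = 0 then (\<lambda>_. 0) else laguerre_int 2 \<alpha> t) \<alpha> t"
proof
  fix p q :: "real poly" and c :: real
  show "laguerre_int 0 \<alpha> t (pderiv p) + \<alpha> * laguerre_int 1 \<alpha> t p - laguerre_int 0 \<alpha> t p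
     + t * (if t = 0 then (\<lambda>_. 0) else laguerre_int 2 \<alpha> t) p = 0"
    using laguerre_by_parts[OF assms, of p] by (cases "t = 0") simp_all
qed (use assms laguerre_int_pCons[of 1 \<alpha> t] laguerre_int_pCons[of 0 \<alpha> t] in
     \<open>auto simp: laguerre_int_add laguerre_int_smult laguerre_int_square_pos
        laguerre_int_square_nonneg numeral_2_eq_2\<close>)

lemma exp_minus_lipschitz:
  fixes a b :: real assumes "a \<ge> 0" "b \<ge> 0"
  shows "\<bar>exp (- a) - exp (- b)\<bar> \<le> \<bar>a - b\<bar>"
proof -
  have *: "exp (- a) - exp (- b) \<le> b - a" if "0 \<le> a" "a \<le> b" for a b :: real
  proof -
    have "1 - exp (a - b) \<le> b - a"
      using exp_ge_add_one_self[of "a - b"] by linarith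
    then have "exp (- a) * (1 - exp (a - b)) \<le> 1 * (b - a)"
      using that by (intro mult_mono) auto
    then show ?thesis by (simp add: algebra_simps flip: exp_add)
  qed
  show ?thesis
    using *[of a b] *[of b a] assms by (cases "a \<le> b") auto
qed

text \<open>The difference quotients of \<open>exp (- t / x)\<close> in \<open>t\<close> are bounded by \<open>1 / x\<close>, uniformly down to \<open>t = 0\<close>.  Hence
the one-sided derivative at \<open>t = 0\<close> is covered as well, which later gives continuity there.\<close>

lemma laguerre_int_has_derivative:
  assumes "\<alpha> > 0" "t \<ge> 0"
  shows "((\<lambda>u. laguerre_int 0 \<alpha> u p) has_real_derivative - laguerre_int 1 \<alpha> t p) (at t within {0..})"
  unfolding has_field_derivative_iff tendsto_at_iff_sequentially
proof (intro allI impI)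
  fix X :: "nat \<Rightarrow> real" assume X: "\<forall>i. X i \<in> {0..} - {t}" and lim: "X \<longlonglongrightarrow> t"
  let ?q = "\<lambda>n x. (poly p x * laguerre_weight (X n) \<alpha> x - poly p x * laguerre_weight t \<alpha> x) / (X n - t)"
  have eq: "(laguerre_int 0 \<alpha> (X n) p - laguerre_int 0 \<alpha> t p) / (X n - t) = (LBINT x:{0<..}. ?q n x)" for n
  proof -
    have "set_integrable lborel {0<..} (\<lambda>x. poly p x * laguerre_weight (X n) \<alpha> x)"
         "set_integrable lborel {0<..} (\<lambda>x. poly p x * laguerre_weight t \<alpha> x)"
      using laguerre_integrable[of \<alpha> "X n" 0 p] laguerre_integrable[of \<alpha> t 0 p] assms X by auto
    then show ?thesis by (simp add: laguerre_int_def set_integral_diff)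
  qed
  have "(\<lambda>n. LBINT x:{0<..}. ?q n x) \<longlonglongrightarrow> (LBINT x:{0<..}. - (poly p x / x * laguerre_weight t \<alpha> x))"
    unfolding set_lebesgue_integral_def
  proof (rule integral_dominated_convergence[where w = "\<lambda>x. norm (indicator {0<..} x *\<^sub>R (poly p x / x * laguerre_weight 0 \<alpha> x))"])
    show "integrable lborel (\<lambda>x. norm (indicator {0<..} x *\<^sub>R (poly p x / x * laguerre_weight 0 \<alpha> x)))"
      using integrable_dominating[OF assms(1), of p] by (intro integrable_norm) (simp add: set_integrable_def)
    show "AE x in lborel. (\<lambda>n. indicator {0<..} x *\<^sub>R ?q n x)
        \<longlonglongrightarrow> indicator {0<..} x *\<^sub>R - (poly p x / x * laguerre_weight t \<alpha> x)"
    proof (rule AE_I2)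
      fix x :: real
      show "(\<lambda>n. indicator {0<..} x *\<^sub>R ?q n x)
        \<longlonglongrightarrow> indicator {0<..} x *\<^sub>R - (poly p x / x * laguerre_weight t \<alpha> x)"
      proof (cases "x > 0")
        case True
        have "((\<lambda>u. poly p x * laguerre_weight u \<alpha> x) has_real_derivative
            - (poly p x / x * laguerre_weight t \<alpha> x)) (at t within {0..})"
          unfolding laguerre_weight_def using True by (auto intro!: derivative_eq_intros)
        then show ?thesis
          unfolding has_field_derivative_iff tendsto_at_iff_sequentially
          using X lim True by (auto simp: o_def)
      qed simp
    qed
    show "AE x in lborel. norm (indicator {0<..} x *\<^sub>R ?q n x)
        \<le> norm (indicator {0<..} x *\<^sub>R (poly p x / x * laguerre_weight 0 \<alpha> x))" for n
    proof (rule AE_I2)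
      fix x :: real
      show "norm (indicator {0<..} x *\<^sub>R ?q n x)
        \<le> norm (indicator {0<..} x *\<^sub>R (poly p x / x * laguerre_weight 0 \<alpha> x))"
      proof (cases "x > 0")
        case True
        have Xn: "X n \<ge> 0" "X n \<noteq> t" using X by auto
        have "\<bar>exp (- (X n / x)) - exp (- (t / x))\<bar> \<le> \<bar>X n / x - t / x\<bar>"
          using True Xn assms by (intro exp_minus_lipschitz) auto
        also have "\<dots> = \<bar>X n - t\<bar> / x" using True by (simp add: abs_if field_simps)
        finally have "\<bar>(exp (- (X n / x)) - exp (- (t / x))) / (X n - t)\<bar> \<le> 1 / x"
          using Xn True by (simp add: field_simps)
        then have "\<bar>poly p x * (x powr \<alpha> * exp (- x))\<bar> * \<bar>(exp (- (X n / x)) - exp (- (t / x))) / (X n - t)\<bar>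
            \<le> \<bar>poly p x * (x powr \<alpha> * exp (- x))\<bar> * (1 / x)"
          by (intro mult_left_mono) auto
        also have "\<bar>poly p x * (x powr \<alpha> * exp (- x))\<bar> * \<bar>(exp (- (X n / x)) - exp (- (t / x))) / (X n - t)\<bar>
            = \<bar>?q n x\<bar>"
          unfolding abs_mult[symmetric] laguerre_weight_def
          by (simp add: exp_diff exp_minus field_simps)
        finally show ?thesis
          using True by (simp add: laguerre_weight_def abs_mult)
      qed simp
    qed
  qed measurable
  also have "(LBINT x:{0<..}. - (poly p x / x * laguerre_weight t \<alpha> x)) = - laguerre_int 1 \<alpha> t p"
    by (simp add: laguerre_int_def set_lebesgue_integral_def)
  finally show "((\<lambda>y. (laguerre_int 0 \<alpha> y p - laguerre_int 0 \<alpha> t p) / (y - t)) \<circ> X) \<longlonglongrightarrow> - laguerre_int 1 \<alpha> t p"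
    by (simp add: o_def eq)
qed

lemma laguerre_int_1_continuous:
  assumes "\<alpha> > 0" "t \<ge> 0"
  shows "((\<lambda>u. laguerre_int 1 \<alpha> u p) \<longlongrightarrow> laguerre_int 1 \<alpha> t p) (at t within {0..})"
  unfolding tendsto_at_iff_sequentially
proof (intro allI impI)
  fix X :: "nat \<Rightarrow> real" assume X: "\<forall>i. X i \<in> {0..} - {t}" and lim: "X \<longlonglongrightarrow> t"
  show "((\<lambda>u. laguerre_int 1 \<alpha> u p) \<circ> X) \<longlonglongrightarrow> laguerre_int 1 \<alpha> t p"
    unfolding o_def laguerre_int_def set_lebesgue_integral_def
  proof (rule integral_dominated_convergence[where w = "\<lambda>x. norm (indicator {0<..} x *\<^sub>R (poly p x / x * laguerre_weight 0 \<alpha> x))"])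
    show "integrable lborel (\<lambda>x. norm (indicator {0<..} x *\<^sub>R (poly p x / x * laguerre_weight 0 \<alpha> x)))"
      using integrable_dominating[OF assms(1), of p] by (intro integrable_norm) (simp add: set_integrable_def)
    have "(\<lambda>n. laguerre_weight (X n) \<alpha> x) \<longlonglongrightarrow> laguerre_weight t \<alpha> x" if "x > 0" for x
      unfolding laguerre_weight_def using that lim by (intro tendsto_intros) auto
    then show "AE x in lborel. (\<lambda>n. indicator {0<..} x *\<^sub>R (poly p x / x ^ 1 * laguerre_weight (X n) \<alpha> x))
        \<longlonglongrightarrow> indicator {0<..} x *\<^sub>R (poly p x / x ^ 1 * laguerre_weight t \<alpha> x)"
      by (intro AE_I2) (auto simp: indicator_def intro!: tendsto_intros)
    show "AE x in lborel. norm (indicator {0<..} x *\<^sub>R (poly p x / x ^ 1 * laguerre_weight (X n) \<alpha> x))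
        \<le> norm (indicator {0<..} x *\<^sub>R (poly p x / x * laguerre_weight 0 \<alpha> x))" for n
      using X weighted_abs_le[of _ "X n" "poly p _ / _" \<alpha>]
      by (intro AE_I2) (auto simp: indicator_def simp del: times_divide_eq_left)
  qed measurable
qed

section \<open>Hankel determinant and recurrence coefficients of the weight\<close>

abbreviation "laguerre_poly \<alpha> n t \<equiv> gram_schmidt (laguerre_int 0 \<alpha> t) n"

text \<open>The quantities above for the Laguerre weight, now as functions of the parameter \<open>t\<close>
that the locale keeps fixed.\<close>

definition "sq_norm \<alpha> n t = pos_functional.h (laguerre_int 0 \<alpha> t) n"
definition "inv_mean \<alpha> n t = laurent_functional.Y (laguerre_int 0 \<alpha> t) (laguerre_int 1 \<alpha> t) n"
definition "inv_cross \<alpha> n t = laurent_functional.R (laguerre_int 0 \<alpha> t) (laguerre_int 1 \<alpha> t) n"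
definition "subleading \<alpha> n t = laurent_functional.subleading_coeff (laguerre_int 0 \<alpha> t) n"

context
  fixes \<alpha> t :: real
  assumes \<alpha>: "\<alpha> > 0" and t: "t \<ge> 0"
begin

interpretation L: laurent_functional "laguerre_int 0 \<alpha> t" "laguerre_int 1 \<alpha> t"
    "if t = 0 then (\<lambda>_. 0) else laguerre_int 2 \<alpha> t" \<alpha> t
  using \<alpha> t by (rule laguerre_functional)

lemma orth_poly_eq: "orth_poly t \<alpha> = gram_schmidt (laguerre_int 0 \<alpha> t)"
proof -
  have int: "(LBINT x:{0<..}. poly p x * poly q x * laguerre_weight t \<alpha> x) = laguerre_int 0 \<alpha> t (p * q)" for p q
    by (simp add: laguerre_int_def)
  show ?thesis
    unfolding orth_poly_def
  proof (rule the_equality)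
    show "is_monic_orthogonal t \<alpha> (gram_schmidt (laguerre_int 0 \<alpha> t))"
      unfolding is_monic_orthogonal_def int
      by (auto simp: gram_schmidt_degree gram_schmidt_coeff_ge L.orthogonal)
    fix Q assume Q: "is_monic_orthogonal t \<alpha> Q"
    show "Q = gram_schmidt (laguerre_int 0 \<alpha> t)"
    proof
      fix n
      show "Q n = gram_schmidt (laguerre_int 0 \<alpha> t) n"
        using Q unfolding is_monic_orthogonal_def int by (intro L.unique_orthogonal) blast+
    qed
  qed
qed

text \<open>Comparing the coefficients of \<open>x\<^sup>n\<close> determines the diagonal coefficient, whatever multiple of
\<open>P\<^sub>n\<^sub>-\<^sub>1\<close> is added.\<close>

lemma rec_alpha_eq: "rec_alpha n t \<alpha> = L.diag_coeff n"
  unfolding rec_alpha_def orth_poly_eq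
proof (rule the_equality)
  show "\<exists>b. [:0, 1:] * L.P n = L.P (Suc n) + Polynomial.smult (L.diag_coeff n) (L.P n) +
      (if n = 0 then 0 else Polynomial.smult b (L.P (n - 1)))"
    using L.three_term[of n, folded L.diag_coeff_def] by blast
  fix a assume "\<exists>b. [:0, 1:] * L.P n = L.P (Suc n) + Polynomial.smult a (L.P n) +
      (if n = 0 then 0 else Polynomial.smult b (L.P (n - 1)))"
  then obtain b where "[:0, 1:] * L.P n = L.P (Suc n) + Polynomial.smult a (L.P n) +
      (if n = 0 then 0 else Polynomial.smult b (L.P (n - 1)))" by blast
  then have "Polynomial.coeff ([:0, 1:] * L.P n) n = Polynomial.coeff (L.P (Suc n) + Polynomial.smult a (L.P n) +
      (if n = 0 then 0 else Polynomial.smult b (L.P (n - 1)))) n" by (rule arg_cong)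
  then have "a = L.subleading_coeff n - L.subleading_coeff (Suc n)"
    by (cases n) (auto simp: L.subleading_coeff_def gram_schmidt_coeff_ge)
  then show "a = L.diag_coeff n" by (simp add: L.diag_coeff_sub)
qed

lemma aux_y_eq: "aux_y n t \<alpha> = t * inv_mean \<alpha> n t"
  by (simp add: aux_y_def rec_alpha_eq L.diag_coeff_eq inv_mean_def)

lemma sq_norm_pos: "sq_norm \<alpha> n t > 0"
  unfolding sq_norm_def by (rule L.h_pos)

text \<open>The unitriangular change of basis from monomials to the \<open>P\<^sub>n\<close> diagonalises the Hankel matrix.\<close>

lemma hankel_det_eq: "hankel_det n t \<alpha> = (\<Prod>j<n. sq_norm \<alpha> j t)"
proof -
  define T where "T = Matrix.mat n n (\<lambda>(i, j). Polynomial.coeff (L.P i) j)"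
  define M where "M = Matrix.mat n n (\<lambda>(j, k). LBINT x:{0<..}. x ^ (j + k) * laguerre_weight t \<alpha> x)"
  have T: "T \<in> carrier_mat n n" and M: "M \<in> carrier_mat n n" by (simp_all add: T_def M_def)
  have TT: "transpose_mat T \<in> carrier_mat n n" using T by simp
  have mom: "(LBINT x:{0<..}. x ^ k * laguerre_weight t \<alpha> x) = laguerre_int 0 \<alpha> t (Polynomial.monom 1 k)" for k
    by (simp add: laguerre_int_def poly_monom)
  have sum: "L.P i = (\<Sum>k<n. Polynomial.monom (Polynomial.coeff (L.P i) k) k)" if "i < n" for i
  proof -
    have "(\<Sum>k<n. Polynomial.monom (Polynomial.coeff (L.P i) k) k) = (\<Sum>k\<le>n - 1. Polynomial.monom (Polynomial.coeff (L.P i) k) k)"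
      using that by (intro sum.cong) auto
    also have "\<dots> = L.P i"
      using that by (intro poly_as_sum_of_monoms') (simp add: gram_schmidt_degree)
    finally show ?thesis by simp
  qed
  have I: "laguerre_int 0 \<alpha> t (L.P i * L.P j) = (\<Sum>l<n. (\<Sum>k<n. Polynomial.coeff (L.P i) k *
      laguerre_int 0 \<alpha> t (Polynomial.monom 1 (k + l))) * Polynomial.coeff (L.P j) l)"
    if "i < n" "j < n" for i j
  proof -
    have m: "laguerre_int 0 \<alpha> t (Polynomial.monom (a * b) (k + l)) = a * laguerre_int 0 \<alpha> t (Polynomial.monom 1 (k + l)) * b" for a b k l
      using L.I0_smult[of "a * b" "Polynomial.monom 1 (k + l)"] by (simp add: Polynomial.smult_monom)
    have "laguerre_int 0 \<alpha> t (L.P i * L.P j) =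
        laguerre_int 0 \<alpha> t ((\<Sum>k<n. Polynomial.monom (Polynomial.coeff (L.P i) k) k) * (\<Sum>l<n. Polynomial.monom (Polynomial.coeff (L.P j) l) l))"
      using sum[OF that(1)] sum[OF that(2)] by metis
    also have "\<dots> = (\<Sum>k<n. \<Sum>l<n. Polynomial.coeff (L.P i) k *
      laguerre_int 0 \<alpha> t (Polynomial.monom 1 (k + l)) * Polynomial.coeff (L.P j) l)"
      by (simp add: sum_product L.I0_sum Polynomial.mult_monom m)
    also have "\<dots> = (\<Sum>l<n. \<Sum>k<n. Polynomial.coeff (L.P i) k *
      laguerre_int 0 \<alpha> t (Polynomial.monom 1 (k + l)) * Polynomial.coeff (L.P j) l)"
      by (rule sum.swap)
    finally show ?thesis by (simp add: sum_distrib_right)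
  qed
  have D: "T * M * transpose_mat T = Matrix.mat n n (\<lambda>(i, j). if i = j then L.h i else 0)"
    (is "?A = ?D")
  proof (rule eq_matI)
    fix i j assume "i < dim_row ?D" "j < dim_col ?D"
    then have ij: "i < n" "j < n" by auto
    have TM: "(T * M) $$ (i, l) = (\<Sum>k<n. Polynomial.coeff (L.P i) k *
        laguerre_int 0 \<alpha> t (Polynomial.monom 1 (k + l)))" if "l < n" for l
      using ij that T M by (simp add: scalar_prod_def lessThan_atLeast0) (simp add: T_def M_def mom)
    have Tj: "T $$ (j, l) = Polynomial.coeff (L.P j) l" if "l < n" for l
      using ij that by (simp add: T_def)
    have "?A $$ (i, j) = (\<Sum>l<n. (T * M) $$ (i, l) * T $$ (j, l))"
      using ij T M
      by (subst index_mult_mat(1))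
         (auto simp: scalar_prod_def lessThan_atLeast0 simp del: index_mult_mat(1) intro!: sum.cong, auto simp: scalar_prod_def)
    also have "\<dots> = (\<Sum>l<n. (\<Sum>k<n. Polynomial.coeff (L.P i) k *
      laguerre_int 0 \<alpha> t (Polynomial.monom 1 (k + l))) * Polynomial.coeff (L.P j) l)"
      by (intro sum.cong) (simp_all add: TM Tj)
    finally show "?A $$ (i, j) = ?D $$ (i, j)"
      using ij L.orthogonal[of i j] by (auto simp: I[symmetric] L.h_def)
  qed (auto simp: T_def M_def)
  have det_T: "Determinant.det T = 1"
    by (subst det_lower_triangular[OF _ T])
       (auto simp: T_def gram_schmidt_coeff_ge prod_list_diag_prod)
  have "Determinant.det ?A = Determinant.det T * Determinant.det M * Determinant.det T"
    using T M TT by (simp add: Determinant.det_mult[of _ n] Determinant.det_transpose[OF T])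
  then have "Determinant.det M = Determinant.det ?A" by (simp add: det_T)
  also have "\<dots> = (\<Prod>j<n. L.h j)"
    unfolding D by (subst det_upper_triangular[of _ n]) (auto simp: prod_list_diag_prod upper_triangular_def lessThan_atLeast0)
  finally show ?thesis by (simp add: hankel_det_def M_def sq_norm_def)
qed

lemma inv_mean_pos: "inv_mean \<alpha> n t > 0"
  unfolding inv_mean_def by (rule L.Y_pos)

lemma inv_mean_le: "inv_mean \<alpha> n t \<le> 1 / \<alpha>"
proof -
  have "0 \<le> (if t = 0 then (\<lambda>_. 0) else laguerre_int 2 \<alpha> t) (L.P n * L.P n) / L.h n"
    using laguerre_int_square_nonneg[of 2 \<alpha> t "L.P n"] L.h_pos[of n] by simp
  with t have "0 \<le> t * ((if t = 0 then (\<lambda>_. 0) else laguerre_int 2 \<alpha> t) (L.P n * L.P n) / L.h n)"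
    by (rule mult_nonneg_nonneg)
  with L.by_parts_square[of n] have "\<alpha> * L.Y n \<le> 1" by linarith
  then show ?thesis using \<alpha> by (simp add: inv_mean_def field_simps)
qed

lemma inv_mean_lower: "1 \<le> (2 * real n + 1 + \<alpha> + t * inv_mean \<alpha> n t) * inv_mean \<alpha> n t"
  using L.one_le_diag_coeff_Y[of n] by (simp add: inv_mean_def L.diag_coeff_eq)

lemma inv_mean_def': "inv_mean \<alpha> n t = laguerre_int 1 \<alpha> t (laguerre_poly \<alpha> n t * laguerre_poly \<alpha> n t) / sq_norm \<alpha> n t"
  by (simp only: inv_mean_def L.Y_def sq_norm_def)

lemma sq_norm_def': "sq_norm \<alpha> n t = laguerre_int 0 \<alpha> t (laguerre_poly \<alpha> n t * laguerre_poly \<alpha> n t)"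
  by (simp add: L.h_def sq_norm_def)

lemma inv_cross_def': "inv_cross \<alpha> (Suc m) t = laguerre_int 1 \<alpha> t (laguerre_poly \<alpha> (Suc m) t * laguerre_poly \<alpha> m t) / sq_norm \<alpha> m t"
  unfolding L.R_def sq_norm_def inv_cross_def by simp

lemma subleading_def': "subleading \<alpha> n t = (if n = 0 then 0 else Polynomial.coeff (laguerre_poly \<alpha> n t) (n - 1))"
  by (simp add: subleading_def L.subleading_coeff_def)

lemma laguerre_orthogonal: "i \<noteq> j \<Longrightarrow> laguerre_int 0 \<alpha> t (laguerre_poly \<alpha> i t * laguerre_poly \<alpha> j t) = 0"
  by (rule L.orthogonal)

lemma laguerre_orth_low: "(\<And>i. i \<ge> n \<Longrightarrow> Polynomial.coeff q i = 0) \<Longrightarrow> laguerre_int 0 \<alpha> t (laguerre_poly \<alpha> n t * q) = 0"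
  by (rule L.P_orth_low)

lemma laguerre_pairing: "(\<And>i. i > n \<Longrightarrow> Polynomial.coeff q i = 0) \<Longrightarrow>
    laguerre_int 0 \<alpha> t (laguerre_poly \<alpha> n t * q) = Polynomial.coeff q n * sq_norm \<alpha> n t"
  unfolding sq_norm_def by (rule L.P_pairing)

lemma subleading_coeff_diff: "subleading \<alpha> n t - subleading \<alpha> (Suc n) t = 2 * real n + 1 + \<alpha> + t * inv_mean \<alpha> n t"
  using L.diag_coeff_sub[of n] L.diag_coeff_eq[of n] by (simp add: subleading_def inv_mean_def)

lemma R_sum: "inv_cross \<alpha> n t + inv_cross \<alpha> (Suc n) t + (2 * real n + 1 + \<alpha> + t * inv_mean \<alpha> n t) * inv_mean \<alpha> n t = 1"
  using L.R_sum[of n] by (simp add: inv_cross_def inv_mean_def L.diag_coeff_eq)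

lemma subleading_coeff_eq: "subleading \<alpha> (Suc m) t = t * inv_cross \<alpha> (Suc m) t - sq_norm \<alpha> (Suc m) t / sq_norm \<alpha> m t"
  using L.subleading_coeff_eq[OF refl, of m] by (simp add: subleading_def inv_cross_def sq_norm_def)

lemma quadratic_relation:
  "sq_norm \<alpha> (Suc m) t / sq_norm \<alpha> m t * inv_mean \<alpha> (Suc m) t * inv_mean \<alpha> m t = (inv_cross \<alpha> (Suc m) t)\<^sup>2 - inv_cross \<alpha> (Suc m) t"
  using L.quadratic_relation[OF refl, of m] by (simp add: inv_mean_def inv_cross_def sq_norm_def)

lemma linear_relation:
  "t \<noteq> 0 \<Longrightarrow> sq_norm \<alpha> (Suc m) t / sq_norm \<alpha> m t * (inv_mean \<alpha> (Suc m) t + inv_mean \<alpha> m t)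
     = real (Suc m) - (2 * real (Suc m) + \<alpha>) * inv_cross \<alpha> (Suc m) t"
  using L.linear_relation[OF refl, of m] by (simp add: inv_mean_def inv_cross_def sq_norm_def)

lemma inv_mean_at_0: "t = 0 \<Longrightarrow> inv_mean \<alpha> n t = 1 / \<alpha>"
  using L.by_parts_square[of n] \<alpha> by (simp add: inv_mean_def field_simps)

end

section \<open>Dependence on the deformation parameter\<close>

text \<open>Differentiability of a polynomial in a parameter, coefficient by coefficient; the one-sided filter admits
the parameter value \<open>0\<close>.\<close>

definition poly_deriv_at :: "(real \<Rightarrow> real poly) \<Rightarrow> real poly \<Rightarrow> real \<Rightarrow> bool" where
  "poly_deriv_at q q' t \<longleftrightarrow>
     (\<forall>i. ((\<lambda>u. Polynomial.coeff (q u) i) has_real_derivative Polynomial.coeff q' i) (at t within {0..}))"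

lemma poly_deriv_at_mult:
  assumes "poly_deriv_at q q' t" "poly_deriv_at r r' t"
  shows "poly_deriv_at (\<lambda>u. q u * r u) (q' * r t + q t * r') t"
  unfolding poly_deriv_at_def
proof
  fix n
  have "((\<lambda>u. \<Sum>i\<le>n. Polynomial.coeff (q u) i * Polynomial.coeff (r u) (n - i)) has_real_derivative
    (\<Sum>i\<le>n. Polynomial.coeff (q t) i * Polynomial.coeff r' (n - i) + Polynomial.coeff q' i * Polynomial.coeff (r t) (n - i)))
    (at t within {0..})"
    using assms unfolding poly_deriv_at_def by (intro DERIV_sum DERIV_mult') auto
  then show "((\<lambda>u. Polynomial.coeff (q u * r u) n) has_real_derivative Polynomial.coeff (q' * r t + q t * r') n) (at t within {0..})"
    by (simp add: coeff_mult sum.distrib add.commute)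
qed

lemma poly_deriv_at_const: "poly_deriv_at (\<lambda>u. q) 0 t"
  by (simp add: poly_deriv_at_def)

context
  fixes \<alpha> :: real
  assumes \<alpha>: "\<alpha> > 0"
begin

lemma laguerre_int_expand:
  assumes "t \<ge> 0" "k \<le> 1" "\<And>i. i > d \<Longrightarrow> Polynomial.coeff q i = 0"
  shows "laguerre_int k \<alpha> t q = (\<Sum>i\<le>d. Polynomial.coeff q i * laguerre_int k \<alpha> t (Polynomial.monom 1 i))"
proof -
  have z: "laguerre_int k \<alpha> t 0 = 0" by (simp add: laguerre_int_def)
  have s: "laguerre_int k \<alpha> t (sum f A) = (\<Sum>i\<in>A. laguerre_int k \<alpha> t (f i))" for f and A :: "nat set"
    using assms \<alpha> by (induction A rule: infinite_finite_induct) (auto simp: z laguerre_int_add)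
  have "q = (\<Sum>i\<le>d. Polynomial.smult (Polynomial.coeff q i) (Polynomial.monom 1 i))"
    using assms(3) poly_as_sum_of_monoms'[of q d] by (simp add: Polynomial.smult_monom Polynomial.degree_le)
  then have "laguerre_int k \<alpha> t q = laguerre_int k \<alpha> t (\<Sum>i\<le>d. Polynomial.smult (Polynomial.coeff q i) (Polynomial.monom 1 i))"
    by (rule arg_cong)
  then show ?thesis by (simp add: s laguerre_int_smult)
qed

text \<open>Both the polynomial and the weight depend on the parameter; the degree bound reduces the product
rule to a finite sum over the moments.\<close>

lemma laguerre_int_poly_deriv:
  assumes t: "t \<ge> 0" and q: "poly_deriv_at q q' t"
    and d: "\<And>u i. i > d \<Longrightarrow> Polynomial.coeff (q u) i = 0" "\<And>i. i > d \<Longrightarrow> Polynomial.coeff q' i = 0"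
  shows "((\<lambda>u. laguerre_int 0 \<alpha> u (q u)) has_real_derivative
     laguerre_int 0 \<alpha> t q' - laguerre_int 1 \<alpha> t (q t)) (at t within {0..})"
proof -
  have "((\<lambda>u. \<Sum>i\<le>d. Polynomial.coeff (q u) i * laguerre_int 0 \<alpha> u (Polynomial.monom 1 i)) has_real_derivative
     (\<Sum>i\<le>d. Polynomial.coeff q' i * laguerre_int 0 \<alpha> t (Polynomial.monom 1 i)
       + - laguerre_int 1 \<alpha> t (Polynomial.monom 1 i) * Polynomial.coeff (q t) i)) (at t within {0..})"
    using q \<alpha> t unfolding poly_deriv_at_def
    by (intro DERIV_sum DERIV_mult laguerre_int_has_derivative) auto
  also have "(\<Sum>i\<le>d. Polynomial.coeff q' i * laguerre_int 0 \<alpha> t (Polynomial.monom 1 i)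
       + - laguerre_int 1 \<alpha> t (Polynomial.monom 1 i) * Polynomial.coeff (q t) i)
      = laguerre_int 0 \<alpha> t q' - laguerre_int 1 \<alpha> t (q t)"
    using d t by (simp add: laguerre_int_expand[of t 0 d q'] laguerre_int_expand[of t 1 d "q t"]
        sum_subtractf sum_negf sum.distrib mult.commute del: One_nat_def)
  finally show ?thesis
    by (rule has_field_derivative_transform_within[where d = 1])
       (use d t in \<open>auto intro!: laguerre_int_expand[symmetric]\<close>)
qed

lemma coeff_mult_high:
  assumes "\<And>i. i > m \<Longrightarrow> Polynomial.coeff p i = 0" "\<And>i. i > n \<Longrightarrow> Polynomial.coeff q i = 0" "k > m + n"
  shows "Polynomial.coeff (p * q :: real poly) k = 0"
  unfolding coeff_mult
proof (intro sum.neutral ballI)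
  fix i
  show "Polynomial.coeff p i * Polynomial.coeff q (k - i) = 0"
    using assms(1)[of i] assms(2)[of "k - i"] assms(3) by (cases "i > m") auto
qed

lemma laguerre_int_product_deriv:
  assumes t: "t \<ge> 0" and q: "poly_deriv_at q q' t" and r: "poly_deriv_at r r' t"
    and m: "\<And>u i. i > m \<Longrightarrow> Polynomial.coeff (q u) i = 0" "\<And>i. i > m \<Longrightarrow> Polynomial.coeff q' i = 0"
    and n: "\<And>u i. i > n \<Longrightarrow> Polynomial.coeff (r u) i = 0" "\<And>i. i > n \<Longrightarrow> Polynomial.coeff r' i = 0"
  shows "((\<lambda>u. laguerre_int 0 \<alpha> u (q u * r u)) has_real_derivative
     laguerre_int 0 \<alpha> t (q' * r t) + laguerre_int 0 \<alpha> t (q t * r') - laguerre_int 1 \<alpha> t (q t * r t)) (at t within {0..})"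
proof -
  have "((\<lambda>u. laguerre_int 0 \<alpha> u (q u * r u)) has_real_derivative
     laguerre_int 0 \<alpha> t (q' * r t + q t * r') - laguerre_int 1 \<alpha> t (q t * r t)) (at t within {0..})"
  proof (rule laguerre_int_poly_deriv[OF t poly_deriv_at_mult[OF q r], of "m + n"])
    fix i assume i: "i > m + n"
    show "Polynomial.coeff (q u * r u) i = 0" for u
      by (rule coeff_mult_high[of m _ n]) (use m n i in auto)
    have 1: "Polynomial.coeff (q' * r t) i = 0"
      by (rule coeff_mult_high[of m _ n]) (use m n i in auto)
    have 2: "Polynomial.coeff (q t * r') i = 0"
      by (rule coeff_mult_high[of m _ n]) (use m n i in auto)
    show "Polynomial.coeff (q' * r t + q t * r') i = 0"
      by (simp only: Polynomial.coeff_add 1 2 add_0)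
  qed
  then show ?thesis using \<alpha> t by (simp add: laguerre_int_add)
qed

text \<open>Since the \<open>P\<^sub>n\<close> are monic, the derivative has degree less than \<open>n\<close>, and so is orthogonal to \<open>P\<^sub>n\<close>.\<close>

lemma laguerre_poly_deriv:
  assumes t: "t \<ge> 0"
  shows "\<exists>q'. poly_deriv_at (laguerre_poly \<alpha> n) q' t \<and> (\<forall>i\<ge>n. Polynomial.coeff q' i = 0)"
proof (induction n rule: less_induct)
  case (less n)
  then obtain D where D: "\<And>j. j < n \<Longrightarrow> poly_deriv_at (laguerre_poly \<alpha> j) (D j) t"
      "\<And>j i. j < n \<Longrightarrow> i \<ge> j \<Longrightarrow> Polynomial.coeff (D j) i = 0"
    by metis
  define c where "c j u = laguerre_int 0 \<alpha> u (Polynomial.monom 1 n * laguerre_poly \<alpha> j u) /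
     laguerre_int 0 \<alpha> u (laguerre_poly \<alpha> j u * laguerre_poly \<alpha> j u)" for j u
  have "\<exists>c'. (c j has_real_derivative c') (at t within {0..})" if j: "j < n" for j
  proof -
    let ?M = "Polynomial.monom 1 n" and ?P = "laguerre_poly \<alpha> j"
    have d1: "((\<lambda>u. laguerre_int 0 \<alpha> u (?M * ?P u)) has_real_derivative laguerre_int 0 \<alpha> t (0 * ?P t)
        + laguerre_int 0 \<alpha> t (?M * D j) - laguerre_int 1 \<alpha> t (?M * ?P t)) (at t within {0..})"
      by (rule laguerre_int_product_deriv[OF t poly_deriv_at_const D(1)[OF j], where m = n and n = j])
         (use D(2) j in \<open>auto simp: gram_schmidt_coeff_ge Polynomial.coeff_monom\<close>)
    have d2: "((\<lambda>u. laguerre_int 0 \<alpha> u (?P u * ?P u)) has_real_derivative laguerre_int 0 \<alpha> t (D j * ?P t)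
        + laguerre_int 0 \<alpha> t (?P t * D j) - laguerre_int 1 \<alpha> t (?P t * ?P t)) (at t within {0..})"
      by (rule laguerre_int_product_deriv[OF t D(1)[OF j] D(1)[OF j], where m = j and n = j])
         (use D(2) j in \<open>auto simp: gram_schmidt_coeff_ge\<close>)
    have nz: "laguerre_int 0 \<alpha> t (laguerre_poly \<alpha> j t * laguerre_poly \<alpha> j t) \<noteq> 0"
      using sq_norm_pos[OF \<alpha> t, of j] sq_norm_def'[OF \<alpha> t, of j] by simp
    show ?thesis
      unfolding c_def by (rule exI) (rule DERIV_divide[OF d1 d2 nz])
  qed
  then obtain c' where c': "\<And>j. j < n \<Longrightarrow> (c j has_real_derivative c' j) (at t within {0..})" by metis
  define q' where "q' = - (\<Sum>j<n. Polynomial.smult (c' j) (laguerre_poly \<alpha> j t) + Polynomial.smult (c j t) (D j))"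
  have P: "laguerre_poly \<alpha> n u = Polynomial.monom 1 n - (\<Sum>j<n. Polynomial.smult (c j u) (laguerre_poly \<alpha> j u))" for u
    unfolding c_def by (rule gram_schmidt.simps)
  have "poly_deriv_at (laguerre_poly \<alpha> n) q' t"
    unfolding poly_deriv_at_def
  proof
    fix i
    have "((\<lambda>u. Polynomial.coeff (Polynomial.monom 1 n) i - (\<Sum>j<n. c j u * Polynomial.coeff (laguerre_poly \<alpha> j u) i)) has_real_derivative
      0 - (\<Sum>j<n. c' j * Polynomial.coeff (laguerre_poly \<alpha> j t) i + Polynomial.coeff (D j) i * c j t)) (at t within {0..})"
      using D(1) c' unfolding poly_deriv_at_def by (intro DERIV_diff DERIV_const DERIV_sum DERIV_mult) auto
    then show "((\<lambda>u. Polynomial.coeff (laguerre_poly \<alpha> n u) i) has_real_derivative Polynomial.coeff q' i) (at t within {0..})"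
      by (subst P) (simp add: q'_def Polynomial.coeff_sum mult.commute)
  qed
  moreover have "Polynomial.coeff q' i = 0" if "i \<ge> n" for i
    using D(2) that by (auto simp: q'_def Polynomial.coeff_sum gram_schmidt_coeff_ge intro!: sum.neutral)
  ultimately show ?case by blast
qed

lemma at_within_nonneg: "t > 0 \<Longrightarrow> at t within {0..} = at (t :: real)"
  by (rule at_within_interior) simp

text \<open>The terms that come from the derivative of the polynomial vanish by orthogonality.\<close>

lemma sq_norm_deriv:
  assumes t: "t \<ge> 0"
  shows "(sq_norm \<alpha> n has_real_derivative - inv_mean \<alpha> n t * sq_norm \<alpha> n t) (at t within {0..})"
proof -
  obtain q' where q': "poly_deriv_at (laguerre_poly \<alpha> n) q' t" "\<And>i. i \<ge> n \<Longrightarrow> Polynomial.coeff q' i = 0"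
    using laguerre_poly_deriv[OF t] by blast
  let ?P = "laguerre_poly \<alpha> n"
  have "((\<lambda>u. laguerre_int 0 \<alpha> u (?P u * ?P u)) has_real_derivative
      laguerre_int 0 \<alpha> t (q' * ?P t) + laguerre_int 0 \<alpha> t (?P t * q') - laguerre_int 1 \<alpha> t (?P t * ?P t)) (at t within {0..})"
    by (rule laguerre_int_product_deriv[OF t q'(1) q'(1), of n n])
       (use q'(2) in \<open>auto simp: gram_schmidt_coeff_ge\<close>)
  also have "laguerre_int 0 \<alpha> t (q' * ?P t) + laguerre_int 0 \<alpha> t (?P t * q') = 0"
    using laguerre_orth_low[OF \<alpha> t q'(2)] by (simp add: mult.commute)
  also have "0 - laguerre_int 1 \<alpha> t (?P t * ?P t) = - inv_mean \<alpha> n t * sq_norm \<alpha> n t"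
    using sq_norm_pos[OF \<alpha> t, of n] by (simp add: inv_mean_def'[OF \<alpha> t])
  finally show ?thesis
    by (rule has_field_derivative_transform_within[where d = 1])
       (use t in \<open>auto simp: sq_norm_def'[OF \<alpha>]\<close>)
qed

text \<open>Differentiating \<open>L (P\<^sub>n P\<^sub>n\<^sub>-\<^sub>1) = 0\<close> leaves the leading coefficient of the derivative of \<open>P\<^sub>n\<close>.\<close>

lemma subleading_deriv:
  assumes t: "t \<ge> 0"
  shows "(subleading \<alpha> n has_real_derivative inv_cross \<alpha> n t) (at t within {0..})"
proof (cases n)
  case 0
  have "inv_cross \<alpha> n t = 0"
    using laurent_functional.R_def[OF laguerre_functional[OF \<alpha> t]] 0 by (simp add: inv_cross_def)
  then have "((\<lambda>u. 0) has_real_derivative inv_cross \<alpha> n t) (at t within {0..})" by simp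
  then show ?thesis
    by (rule has_field_derivative_transform_within[where d = 1])
       (use t 0 in \<open>auto simp: subleading_def'[OF \<alpha>]\<close>)
next
  case (Suc m)
  obtain q' where q': "poly_deriv_at (laguerre_poly \<alpha> n) q' t" "\<And>i. i \<ge> n \<Longrightarrow> Polynomial.coeff q' i = 0"
    using laguerre_poly_deriv[OF t] by blast
  obtain r' where r': "poly_deriv_at (laguerre_poly \<alpha> m) r' t" "\<And>i. i \<ge> m \<Longrightarrow> Polynomial.coeff r' i = 0"
    using laguerre_poly_deriv[OF t] by blast
  let ?P = "laguerre_poly \<alpha> n" and ?Q = "laguerre_poly \<alpha> m"
  have "((\<lambda>u. laguerre_int 0 \<alpha> u (?P u * ?Q u)) has_real_derivative
      laguerre_int 0 \<alpha> t (q' * ?Q t) + laguerre_int 0 \<alpha> t (?P t * r') - laguerre_int 1 \<alpha> t (?P t * ?Q t)) (at t within {0..})"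
    by (rule laguerre_int_product_deriv[OF t q'(1) r'(1), of n m])
       (use q'(2) r'(2) in \<open>auto simp: gram_schmidt_coeff_ge\<close>)
  then have "((\<lambda>u. 0) has_real_derivative
      laguerre_int 0 \<alpha> t (q' * ?Q t) + laguerre_int 0 \<alpha> t (?P t * r') - laguerre_int 1 \<alpha> t (?P t * ?Q t)) (at t within {0..})"
    by (rule has_field_derivative_transform_within[where d = 1])
       (use t Suc in \<open>auto simp: laguerre_orthogonal[OF \<alpha>]\<close>)
  moreover have "((\<lambda>u. 0) has_real_derivative 0) (at t within {0..})" by simp
  moreover have "at t within {0..} \<noteq> bot"
  proof
    assume "at t within {0..} = bot"
    moreover have "{t<..} \<subseteq> {0..}" using t by auto
    ultimately have "at_right t \<le> bot" using at_le[of "{t<..}" "{0..}" t] by simp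
    then show False by (simp add: bot_unique)
  qed
  ultimately have "laguerre_int 0 \<alpha> t (q' * ?Q t) + laguerre_int 0 \<alpha> t (?P t * r') = laguerre_int 1 \<alpha> t (?P t * ?Q t)"
    using tendsto_unique unfolding has_field_derivative_iff by fastforce
  also have "laguerre_int 0 \<alpha> t (q' * ?Q t) + laguerre_int 0 \<alpha> t (?P t * r') = Polynomial.coeff q' m * sq_norm \<alpha> m t"
    using laguerre_pairing[OF \<alpha> t, of m q'] laguerre_orth_low[OF \<alpha> t, of n r'] q'(2) r'(2) Suc
    by (simp add: mult.commute)
  finally have "Polynomial.coeff q' m = inv_cross \<alpha> n t"
    using sq_norm_pos[OF \<alpha> t, of m] by (simp add: inv_cross_def'[OF \<alpha> t] Suc field_simps)
  moreover have "((\<lambda>u. Polynomial.coeff (?P u) m) has_real_derivative Polynomial.coeff q' m) (at t within {0..})"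
    using q'(1) by (simp add: poly_deriv_at_def)
  ultimately have "((\<lambda>u. Polynomial.coeff (?P u) m) has_real_derivative inv_cross \<alpha> n t) (at t within {0..})" by simp
  then show ?thesis
    by (rule has_field_derivative_transform_within[where d = 1])
       (use t Suc in \<open>auto simp: subleading_def'[OF \<alpha>]\<close>)
qed

lemma inv_mean_continuous_0: "(inv_mean \<alpha> n \<longlongrightarrow> 1 / \<alpha>) (at_right 0)"
proof -
  let ?P = "laguerre_poly \<alpha> n" and ?F = "at 0 within {0..} :: real filter"
  obtain q' where q': "poly_deriv_at (laguerre_poly \<alpha> n) q' 0" "\<And>i. i \<ge> n \<Longrightarrow> Polynomial.coeff q' i = 0"
    using laguerre_poly_deriv[of 0] by auto
  define d where "d = n + n"
  have hi: "Polynomial.coeff (?P u * ?P u) i = 0" if "i > d" for i u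
    using that by (auto simp: d_def gram_schmidt_coeff_ge intro!: coeff_mult_high[of n _ n])
  have "((\<lambda>u. Polynomial.coeff (?P u * ?P u) i) \<longlongrightarrow> Polynomial.coeff (?P 0 * ?P 0) i) ?F" for i
    using poly_deriv_at_mult[OF q'(1) q'(1)] unfolding poly_deriv_at_def
    by (meson DERIV_continuous continuous_within)
  then have "((\<lambda>u. \<Sum>i\<le>d. Polynomial.coeff (?P u * ?P u) i * laguerre_int 1 \<alpha> u (Polynomial.monom 1 i)) \<longlongrightarrow>
     (\<Sum>i\<le>d. Polynomial.coeff (?P 0 * ?P 0) i * laguerre_int 1 \<alpha> 0 (Polynomial.monom 1 i))) ?F"
    using \<alpha> by (intro tendsto_sum tendsto_mult laguerre_int_1_continuous) auto
  then have "((\<lambda>u. \<Sum>i\<le>d. Polynomial.coeff (?P u * ?P u) i * laguerre_int 1 \<alpha> u (Polynomial.monom 1 i)) \<longlongrightarrow>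
     laguerre_int 1 \<alpha> 0 (?P 0 * ?P 0)) ?F"
    using laguerre_int_expand[of 0 1 d "?P 0 * ?P 0"] hi by simp
  moreover have "(sq_norm \<alpha> n \<longlongrightarrow> sq_norm \<alpha> n 0) ?F"
    using sq_norm_deriv[of 0 n] DERIV_continuous unfolding continuous_within by blast
  ultimately have "((\<lambda>u. (\<Sum>i\<le>d. Polynomial.coeff (?P u * ?P u) i * laguerre_int 1 \<alpha> u (Polynomial.monom 1 i)) / sq_norm \<alpha> n u) \<longlongrightarrow>
     laguerre_int 1 \<alpha> 0 (?P 0 * ?P 0) / sq_norm \<alpha> n 0) ?F"
    using sq_norm_pos[OF \<alpha>, of 0 n] by (intro tendsto_divide) auto
  also have "laguerre_int 1 \<alpha> 0 (?P 0 * ?P 0) / sq_norm \<alpha> n 0 = 1 / \<alpha>"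
    using inv_mean_def'[OF \<alpha>, of 0 n] inv_mean_at_0[OF \<alpha>, of 0 n] by simp
  finally have "((\<lambda>u. (\<Sum>i\<le>d. Polynomial.coeff (?P u * ?P u) i * laguerre_int 1 \<alpha> u (Polynomial.monom 1 i)) / sq_norm \<alpha> n u) \<longlongrightarrow> 1 / \<alpha>) ?F" .
  then have "((\<lambda>u. (\<Sum>i\<le>d. Polynomial.coeff (?P u * ?P u) i * laguerre_int 1 \<alpha> u (Polynomial.monom 1 i)) / sq_norm \<alpha> n u) \<longlongrightarrow> 1 / \<alpha>) (at_right 0)"
    by (rule tendsto_within_subset) auto
  moreover have "\<forall>\<^sub>F u in at_right 0. (\<Sum>i\<le>d. Polynomial.coeff (?P u * ?P u) i * laguerre_int 1 \<alpha> u (Polynomial.monom 1 i)) / sq_norm \<alpha> n u = inv_mean \<alpha> n u"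
    unfolding eventually_at_filter
    using hi by (intro always_eventually) (auto simp: inv_mean_def'[OF \<alpha>] laguerre_int_expand[of _ 1 d "?P _ * ?P _"] simp del: One_nat_def)
  ultimately show ?thesis by (simp add: tendsto_cong)
qed

end

section \<open>The Painleve equation at finite size\<close>

text \<open>The logarithmic derivative \<open>t Y\<^sub>n' / Y\<^sub>n\<close>, written through \<open>R\<^sub>n\<close> and \<open>Y\<^sub>n\<close>.  Taking it as second
unknown in place of \<open>R\<^sub>n\<close> makes the system a scalar equation of second order for \<open>ln Y\<^sub>n\<close>.\<close>

definition "log_slope \<alpha> n t = 2 * inv_cross \<alpha> n t / inv_mean \<alpha> n t + (2 * real n + \<alpha>) + t * inv_mean \<alpha> n t - 1 / inv_mean \<alpha> n t"

context
  fixes \<alpha> :: real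
  assumes \<alpha>: "\<alpha> > 0"
begin

text \<open>The sum of \<open>R\<^sub>n\<close> and \<open>R\<^sub>n\<^sub>+\<^sub>1\<close> is known, so their difference, which is the derivative of \<open>t Y\<^sub>n\<close>,
involves the index \<open>n\<close> only.\<close>

lemma inv_mean_deriv:
  assumes t: "t > 0"
  shows "(inv_mean \<alpha> n has_real_derivative inv_mean \<alpha> n t * log_slope \<alpha> n t / t) (at t)"
proof -
  define Y R W where "Y = inv_mean \<alpha> n t" and "R = inv_cross \<alpha> n t" and "W = log_slope \<alpha> n t"
  define N where "N = 2 * real n + 1 + \<alpha>"
  have Y: "Y > 0" unfolding Y_def using \<alpha> t by (intro inv_mean_pos) auto
  have sub: "(subleading \<alpha> k has_real_derivative inv_cross \<alpha> k t) (at t)" for k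
    using subleading_deriv[OF \<alpha>, of t k] t by (simp add: at_within_nonneg[OF \<alpha>])
  have "((\<lambda>u. (subleading \<alpha> n u - subleading \<alpha> (Suc n) u - N) / u) has_real_derivative
      ((R - inv_cross \<alpha> (Suc n) t - 0) * t - (subleading \<alpha> n t - subleading \<alpha> (Suc n) t - N) * 1) / (t * t)) (at t)"
    unfolding R_def using t by (intro DERIV_divide DERIV_diff sub DERIV_const DERIV_ident) auto
  also have "inv_cross \<alpha> (Suc n) t = 1 - R - (N + t * Y) * Y"
    using R_sum[OF \<alpha>, of t n] t by (simp add: R_def Y_def N_def)
  also have "subleading \<alpha> n t - subleading \<alpha> (Suc n) t - N = t * Y"
    using subleading_coeff_diff[OF \<alpha>, of t n] t by (simp add: Y_def N_def)
  also have "((R - (1 - R - (N + t * Y) * Y) - 0) * t - t * Y * 1) / (t * t) = Y * W / t"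
    using Y t unfolding W_def log_slope_def Y_def[symmetric] R_def[symmetric] N_def
    by (simp add: field_simps)
  finally show ?thesis
    unfolding Y_def W_def
    by (rule has_field_derivative_transform_within_open[of _ _ _ "{0<..}"])
       (use t subleading_coeff_diff[OF \<alpha>, of _ n] in \<open>auto simp: N_def\<close>)
qed

text \<open>The derivative of the off-diagonal coefficient brings in \<open>Y\<^sub>n\<^sub>-\<^sub>1\<close>, which the quadratic and the linear
relation eliminate.\<close>

lemma inv_cross_deriv:
  assumes t: "t > 0" and n: "n = Suc m"
  shows "(inv_cross \<alpha> n has_real_derivative (2 * ((inv_cross \<alpha> n t)\<^sup>2 - inv_cross \<alpha> n t) / inv_mean \<alpha> n t - real n
     + (2 * real n + \<alpha>) * inv_cross \<alpha> n t) / t) (at t)"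
proof -
  define Y Y' R h h' where "Y = inv_mean \<alpha> n t" and "Y' = inv_mean \<alpha> m t" and "R = inv_cross \<alpha> n t"
    and "h = sq_norm \<alpha> n t" and "h' = sq_norm \<alpha> m t"
  have Y: "Y > 0" unfolding Y_def using \<alpha> t by (intro inv_mean_pos) auto
  have h': "h' > 0" unfolding h'_def using \<alpha> t by (intro sq_norm_pos) auto
  have sub: "(subleading \<alpha> n has_real_derivative R) (at t)"
    using subleading_deriv[OF \<alpha>, of t n] t by (simp add: at_within_nonneg[OF \<alpha>] R_def)
  have sq: "(sq_norm \<alpha> k has_real_derivative - inv_mean \<alpha> k t * sq_norm \<alpha> k t) (at t)" for k
    using sq_norm_deriv[OF \<alpha>, of t k] t by (simp add: at_within_nonneg[OF \<alpha>])
  have "((\<lambda>u. (subleading \<alpha> n u + sq_norm \<alpha> n u / sq_norm \<alpha> m u) / u) has_real_derivative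
      ((R + (- Y * h * h' - h * (- Y' * h')) / (h' * h')) * t - (subleading \<alpha> n t + h / h') * 1) / (t * t)) (at t)"
    unfolding Y_def Y'_def h_def h'_def using t h'[unfolded h'_def]
    by (intro DERIV_divide DERIV_add sub sq DERIV_ident) auto
  also have "subleading \<alpha> n t + h / h' = t * R"
    using subleading_coeff_eq[OF \<alpha>, of t m] t by (simp add: n h_def h'_def R_def)
  also have "(- Y * h * h' - h * (- Y' * h')) / (h' * h') = h / h' * Y' - h / h' * Y"
    using h' by (simp add: field_simps)
  also have "h / h' * Y = real n - (2 * real n + \<alpha>) * R - h / h' * Y'"
    using linear_relation[OF \<alpha>, of t m] t
    by (simp add: n h_def h'_def R_def Y_def Y'_def algebra_simps add_divide_distrib)
  also have "h / h' * Y' = (R\<^sup>2 - R) / Y"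
    using quadratic_relation[OF \<alpha>, of t m] t Y
    by (simp add: n h_def h'_def R_def Y_def Y'_def field_simps)
  also have "((R + ((R\<^sup>2 - R) / Y - (real n - (2 * real n + \<alpha>) * R - (R\<^sup>2 - R) / Y))) * t - t * R * 1) / (t * t)
      = (2 * (R\<^sup>2 - R) / Y - real n + (2 * real n + \<alpha>) * R) / t"
    using t Y by (simp add: field_simps)
  finally have *: "((\<lambda>u. (subleading \<alpha> n u + sq_norm \<alpha> n u / sq_norm \<alpha> m u) / u) has_real_derivative
      (2 * (R\<^sup>2 - R) / Y - real n + (2 * real n + \<alpha>) * R) / t) (at t)" .
  then show ?thesis
    unfolding Y_def R_def
    by (rule has_field_derivative_transform_within_open[of _ _ _ "{0<..}"])
       (use t subleading_coeff_eq[OF \<alpha>, of _ m] in \<open>auto simp: n\<close>)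
qed

text \<open>With \<open>t = e\<^sup>x / (2n + 1 + \<alpha>)\<close> the operator \<open>t d/dt\<close> is \<open>d/dx\<close>; this is the Painleve equation of \<open>Y\<^sub>n\<close>
in logarithmic form.\<close>

lemma log_slope_deriv:
  assumes t: "t > 0" and n: "n = Suc m"
  shows "(log_slope \<alpha> n has_real_derivative ((2 * real n + 1 + \<alpha>) * (t * inv_mean \<alpha> n t) + (t * inv_mean \<alpha> n t)\<^sup>2
     + \<alpha> / inv_mean \<alpha> n t - 1 / (inv_mean \<alpha> n t)\<^sup>2) / t) (at t)"
proof -
  define Y R W where "Y = inv_mean \<alpha> n t" and "R = inv_cross \<alpha> n t" and "W = log_slope \<alpha> n t"
  have Y: "Y > 0" unfolding Y_def using \<alpha> t by (intro inv_mean_pos) auto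
  have R: "R = Y * (W - (2 * real n + \<alpha>) - t * Y + 1 / Y) / 2"
    using Y unfolding W_def log_slope_def Y_def[symmetric] R_def[symmetric] by (simp add: field_simps)
  define R' where "R' = (2 * (R\<^sup>2 - R) / Y - real n + (2 * real n + \<alpha>) * R) / t"
  note dY = inv_mean_deriv[OF t, of n, folded Y_def W_def]
  note dR = inv_cross_deriv[OF t n, folded Y_def R_def, folded R'_def]
  have "(log_slope \<alpha> n has_real_derivative
      ((2 * R') * Y - (2 * R) * (Y * W / t)) / (Y * Y) + 0 + (1 * Y + Y * W / t * t) - (0 * Y - 1 * (Y * W / t)) / (Y * Y)) (at t)"
    unfolding log_slope_def Y_def R_def using Y[unfolded Y_def]
    by (intro DERIV_diff DERIV_add DERIV_divide DERIV_mult DERIV_cmult DERIV_const DERIV_ident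
        dY[unfolded Y_def] dR) auto
  also have "((2 * R') * Y - (2 * R) * (Y * W / t)) / (Y * Y) + 0 + (1 * Y + Y * W / t * t) - (0 * Y - 1 * (Y * W / t)) / (Y * Y)
     = (2 * (t * R') / Y - 2 * R * W / Y + t * Y + t * Y * W + W / Y) / t"
    using Y t by (simp add: field_simps)
  also have "t * R' = 2 * (R\<^sup>2 - R) / Y - real n + (2 * real n + \<alpha>) * R"
    using t by (simp add: R'_def)
  also have "2 * (2 * (R\<^sup>2 - R) / Y - real n + (2 * real n + \<alpha>) * R) / Y - 2 * R * W / Y + t * Y + t * Y * W + W / Y
      = (2 * real n + 1 + \<alpha>) * (t * Y) + (t * Y)\<^sup>2 + \<alpha> / Y - 1 / Y\<^sup>2"
    unfolding R using Y by (simp add: field_simps power2_eq_square)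
  finally show ?thesis by (simp add: Y_def)
qed

lemma log_hankel_eq:
  assumes "u \<ge> 0"
  shows "ln (hankel_det n u \<alpha> / hankel_det n 0 \<alpha>) = (\<Sum>j<n. ln (sq_norm \<alpha> j u) - ln (sq_norm \<alpha> j 0))"
proof -
  have "ln (hankel_det n u \<alpha>) = (\<Sum>j<n. ln (sq_norm \<alpha> j u))" if "u \<ge> 0" for u
    unfolding hankel_det_eq[OF \<alpha> that] by (rule ln_prod) (use sq_norm_pos[OF \<alpha> that] in \<open>auto simp: less_imp_neq[symmetric]\<close>)
  moreover have "hankel_det n u \<alpha> > 0" if "u \<ge> 0" for u
    using sq_norm_pos[OF \<alpha> that] by (simp add: hankel_det_eq[OF \<alpha> that] prod_pos)
  ultimately show ?thesis
    using assms by (simp add: ln_divide_pos sum_subtractf)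
qed

lemma hankel_ratio_pos: "u \<ge> 0 \<Longrightarrow> hankel_det n u \<alpha> / hankel_det n 0 \<alpha> > 0"
  using sq_norm_pos[OF \<alpha>] by (auto simp: hankel_det_eq[OF \<alpha>] intro!: divide_pos_pos prod_pos)

lemma log_hankel_deriv:
  assumes t: "t \<ge> 0"
  shows "((\<lambda>u. ln (hankel_det n u \<alpha> / hankel_det n 0 \<alpha>)) has_real_derivative - (\<Sum>j<n. inv_mean \<alpha> j t)) (at t within {0..})"
proof -
  have "((\<lambda>u. ln (sq_norm \<alpha> j u) - ln (sq_norm \<alpha> j 0)) has_real_derivative - inv_mean \<alpha> j t) (at t within {0..})" for j
    using sq_norm_pos[OF \<alpha> t, of j]
    by (auto intro!: derivative_eq_intros sq_norm_deriv[OF \<alpha> t])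
  then have "((\<lambda>u. \<Sum>j<n. ln (sq_norm \<alpha> j u) - ln (sq_norm \<alpha> j 0)) has_real_derivative (\<Sum>j<n. - inv_mean \<alpha> j t)) (at t within {0..})"
    by (intro DERIV_sum)
  then have "((\<lambda>u. ln (hankel_det n u \<alpha> / hankel_det n 0 \<alpha>)) has_real_derivative (\<Sum>j<n. - inv_mean \<alpha> j t)) (at t within {0..})"
    by (rule has_field_derivative_transform_within[where d = 1]) (use t in \<open>auto simp: log_hankel_eq\<close>)
  then show ?thesis by (simp add: sum_negf)
qed

lemma log_deriv_H_eq:
  assumes "t \<ge> 0"
  shows "log_deriv_H n t \<alpha> = - t * (\<Sum>j<n. inv_mean \<alpha> j t)"
proof (cases "t = 0")
  case False
  then show ?thesis
    using DERIV_imp_deriv[of "\<lambda>u. ln (hankel_det n u \<alpha> / hankel_det n 0 \<alpha>)"]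
      log_hankel_deriv[OF assms, of n] assms
    by (simp add: log_deriv_H_def at_within_nonneg[OF \<alpha>])
qed (simp add: log_deriv_H_def)

text \<open>The sum of the \<open>Y\<^sub>j\<close> telescopes into the subleading coefficient, which the relations between neighbours
express through quantities of index \<open>n\<close>.\<close>

lemma log_deriv_H_closed_form:
  assumes t: "t > 0" and n: "n = Suc m"
  defines "Y \<equiv> inv_mean \<alpha> n t"
  shows "log_deriv_H n t \<alpha> = 1 / 4 * (log_slope \<alpha> n t)\<^sup>2 - (2 * real n + \<alpha>) * (t * Y) / 2 - (t * Y)\<^sup>2 / 4
     - 1 / 4 * (1 / Y - \<alpha>)\<^sup>2 + t / 2"
proof -
  define Y' R W b where "Y' = inv_mean \<alpha> m t" and "R = inv_cross \<alpha> n t" and "W = log_slope \<alpha> n t"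
    and "b = sq_norm \<alpha> n t / sq_norm \<alpha> m t"
  have Y: "Y > 0" unfolding Y_def using \<alpha> t by (intro inv_mean_pos) auto
  have "subleading \<alpha> k t = - (real k)\<^sup>2 - real k * \<alpha> - t * (\<Sum>j<k. inv_mean \<alpha> j t)" for k
  proof (induction k)
    case 0
    then show ?case using subleading_def'[OF \<alpha>, of t 0] t by simp
  next
    case (Suc k)
    then show ?case using subleading_coeff_diff[OF \<alpha>, of t k] t
      by (simp add: power2_eq_square algebra_simps)
  qed
  then have "log_deriv_H n t \<alpha> = (real n)\<^sup>2 + real n * \<alpha> + subleading \<alpha> n t"
    using t by (simp add: log_deriv_H_eq)
  also have "subleading \<alpha> n t = t * R - b"
    using subleading_coeff_eq[OF \<alpha>, of t m] t by (simp add: n R_def b_def)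
  also have "b = (real n - (2 * real n + \<alpha>) * R) / Y - (R\<^sup>2 - R) / Y\<^sup>2"
  proof -
    have "b * (Y + Y') = real n - (2 * real n + \<alpha>) * R"
      using linear_relation[OF \<alpha>, of t m] t by (simp add: n b_def R_def Y_def Y'_def)
    moreover have "b * Y' = (R\<^sup>2 - R) / Y"
      using quadratic_relation[OF \<alpha>, of t m] t Y
      by (simp add: n b_def R_def Y_def Y'_def field_simps)
    ultimately have "b * Y = real n - (2 * real n + \<alpha>) * R - (R\<^sup>2 - R) / Y"
      by (simp add: distrib_left)
    then have "b = (real n - (2 * real n + \<alpha>) * R - (R\<^sup>2 - R) / Y) / Y"
      using Y by (metis nonzero_mult_div_cancel_right less_irrefl)
    then show ?thesis by (simp add: diff_divide_distrib power2_eq_square)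
  qed
  finally have H: "log_deriv_H n t \<alpha> = (real n)\<^sup>2 + real n * \<alpha> + (t * R -
      ((real n - (2 * real n + \<alpha>) * R) / Y - (R\<^sup>2 - R) / Y\<^sup>2))" .
  \<comment> \<open>with \<open>r = R / Y\<close> and \<open>X = 1 / Y\<close> the claim is a polynomial identity\<close>
  define X y r where "X = 1 / Y" and "y = t * Y" and "r = R / Y"
  have yX: "y * X = t" and R: "R = r * Y" and W: "W = 2 * r + (2 * real n + \<alpha>) + y - X"
    using Y by (simp_all add: X_def y_def r_def W_def log_slope_def flip: Y_def R_def)
  have "t * R = y * r" by (simp add: y_def R)
  moreover have "(real n - (2 * real n + \<alpha>) * R) / Y = real n * X - (2 * real n + \<alpha>) * r"
    using Y by (simp add: X_def R field_simps)
  moreover have "(R\<^sup>2 - R) / Y\<^sup>2 = r\<^sup>2 - r * X"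
    using Y by (simp add: X_def R field_simps power2_eq_square)
  ultimately have "log_deriv_H n t \<alpha> = (real n)\<^sup>2 + real n * \<alpha> + y * r - real n * X
      + (2 * real n + \<alpha>) * r + r\<^sup>2 - r * X" unfolding H by simp
  also have "\<dots> = 1 / 4 * W\<^sup>2 - (2 * real n + \<alpha>) * y / 2 - y\<^sup>2 / 4 - 1 / 4 * (X - \<alpha>)\<^sup>2 + y * X / 2"
    unfolding W by (simp add: field_simps power2_eq_square)
  finally show ?thesis
    by (simp only: yX) (simp add: X_def y_def W_def)
qed

end

section \<open>A comparison principle and limits of second order equations\<close>

text \<open>With \<open>x = ln s\<close> and \<open>u = ln C\<close> this is \<open>s C + \<epsilon> (s C)\<^sup>2 + \<alpha> / C - 1 / C\<^sup>2\<close>, the right-hand side of the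
equation for \<open>(s d/ds)\<^sup>2 ln C\<close>.  The limit equation has \<open>\<epsilon> = 0\<close>, matrices of size \<open>n\<close> have \<open>\<epsilon> = (2n + 1 + \<alpha>)\<^sup>-\<^sup>2\<close>.\<close>

definition painleve_rhs :: "real \<Rightarrow> real \<Rightarrow> real \<Rightarrow> real \<Rightarrow> real" where
  "painleve_rhs \<alpha> \<epsilon> x u = exp (x + u) + \<epsilon> * (exp (x + u))\<^sup>2 + \<alpha> * exp (- u) - (exp (- u))\<^sup>2"

text \<open>The decrease of \<open>\<alpha> e\<^sup>-\<^sup>u\<close> is outweighed by the increase of \<open>- e\<^sup>-\<^sup>2\<^sup>u\<close> because \<open>e\<^sup>-\<^sup>u \<ge> \<alpha>\<close>.\<close>

lemma painleve_rhs_monotone: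
  assumes "\<alpha> > 0" "0 \<le> \<epsilon>'" "\<epsilon>' \<le> \<epsilon>" "v \<le> u" "u \<le> - ln \<alpha>"
  shows "painleve_rhs \<alpha> \<epsilon> x u - painleve_rhs \<alpha> \<epsilon>' x v \<ge> \<alpha>\<^sup>2 * (u - v)"
proof -
  define a b where "a = exp (- u)" and "b = exp (- v)"
  have a: "\<alpha> \<le> a"
  proof -
    have "ln \<alpha> \<le> - u" using assms(5) by simp
    then have "exp (ln \<alpha>) \<le> exp (- u)" by (simp only: exp_le_cancel_iff)
    then show ?thesis using assms(1) by (simp add: a_def)
  qed
  have ab: "a \<le> b" using assms(4) by (simp add: a_def b_def)
  have e: "exp (x + v) \<le> exp (x + u)" using assms(4) by simp
  then have "(exp (x + v))\<^sup>2 \<le> (exp (x + u))\<^sup>2" by (intro power_mono) auto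
  then have e2: "\<epsilon>' * (exp (x + v))\<^sup>2 \<le> \<epsilon> * (exp (x + u))\<^sup>2" using assms by (intro mult_mono) auto
  have "b = a * exp (u - v)" by (simp add: a_def b_def flip: exp_add)
  also have "\<dots> \<ge> a * (1 + (u - v))"
    using exp_ge_add_one_self[of "u - v"] a assms by (intro mult_left_mono) auto
  finally have "b - a \<ge> a * (u - v)" by (simp add: algebra_simps)
  moreover have "a * (u - v) \<ge> \<alpha> * (u - v)" using a assms by (intro mult_right_mono) auto
  ultimately have ba: "b - a \<ge> \<alpha> * (u - v)" by linarith
  have "\<alpha>\<^sup>2 * (u - v) = \<alpha> * (\<alpha> * (u - v))" by (simp add: power2_eq_square)
  also have "\<dots> \<le> \<alpha> * (b - a)" using ba assms by (intro mult_left_mono) auto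
  also have "\<dots> \<le> (a + b - \<alpha>) * (b - a)" using a ab by (intro mult_right_mono) auto
  also have "\<dots> = (\<alpha> * a - a\<^sup>2) - (\<alpha> * b - b\<^sup>2)" by (simp add: power2_eq_square algebra_simps)
  finally show ?thesis using e e2 unfolding painleve_rhs_def a_def b_def by linarith
qed

lemma second_derivative_at_max:
  fixes g g' :: "real \<Rightarrow> real"
  assumes "\<And>x. (g has_real_derivative g' x) (at x)" "(g' has_real_derivative c) (at x0)"
    and "\<And>x. g x \<le> g x0"
  shows "c \<le> 0"
proof (rule ccontr)
  assume "\<not> c \<le> 0"
  then have c: "c > 0" by simp
  have "g' x0 = 0"
    using DERIV_local_max[OF assms(1)[of x0], of 1] assms(3) by auto
  then obtain d where d: "d > 0" "\<And>h. h > 0 \<Longrightarrow> h < d \<Longrightarrow> 0 < g' (x0 + h)"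
    using DERIV_pos_inc_right[OF assms(2) c] by auto
  obtain z where "z > x0" "z < x0 + d / 2" "g (x0 + d / 2) - g x0 = (x0 + d / 2 - x0) * g' z"
    using MVT2[of x0 "x0 + d / 2" g g'] assms(1) d(1) by auto
  moreover have "g' z > 0" using d(2)[of "z - x0"] calculation d(1) by auto
  ultimately have "g (x0 + d / 2) > g x0" using d(1) by (smt (verit) mult_pos_pos)
  with assms(3)[of "x0 + d / 2"] show False by simp
qed

lemma attains_max:
  fixes g :: "real \<Rightarrow> real"
  assumes "continuous_on UNIV g" "\<forall>\<^sub>F x in at_top. g x < g a" "\<forall>\<^sub>F x in at_bot. g x < g a"
  shows "\<exists>x0. \<forall>x. g x \<le> g x0"
proof -
  obtain B where B: "\<And>x. x \<ge> B \<Longrightarrow> g x < g a" using assms(2) by (auto simp: eventually_at_top_linorder)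
  obtain A where A: "\<And>x. x \<le> A \<Longrightarrow> g x < g a" using assms(3) by (auto simp: eventually_at_bot_linorder)
  have aAB: "a \<in> {A..B}" using A[of a] B[of a] by force
  have "\<exists>x0\<in>{A..B}. \<forall>x\<in>{A..B}. g x \<le> g x0"
    using aAB by (intro continuous_attains_sup continuous_on_subset[OF assms(1)]) auto
  then obtain x0 where "x0 \<in> {A..B}" and x0: "\<And>x. x \<in> {A..B} \<Longrightarrow> g x \<le> g x0" by blast
  have "g x \<le> g x0" for x
    using x0[of x] x0[OF aAB] A[of x] B[of x] by (cases "x \<in> {A..B}") force+
  then show ?thesis by blast
qed

text \<open>A maximum principle.  Where \<open>u > v\<close>, the difference satisfies \<open>(u - v)'' \<ge> \<alpha>\<^sup>2 (u - v)\<close>, while the barrier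
\<open>\<delta> exp (\<alpha> x / 2)\<close> has a second derivative of only \<open>\<alpha>\<^sup>2 / 4\<close> times itself.  So \<open>u - v - \<delta> exp (\<alpha> x / 2)\<close>
has no positive maximum; the growth conditions force one if it is positive somewhere.\<close>

lemma painleve_rhs_comparison:
  fixes u v u' v' :: "real \<Rightarrow> real"
  assumes \<alpha>: "\<alpha> > 0" and \<epsilon>: "0 \<le> \<epsilon>'" "\<epsilon>' \<le> \<epsilon>"
    and u: "\<And>x. (u has_real_derivative u' x) (at x)" "\<And>x. (u' has_real_derivative painleve_rhs \<alpha> \<epsilon> x (u x)) (at x)"
    and v: "\<And>x. (v has_real_derivative v' x) (at x)" "\<And>x. (v' has_real_derivative painleve_rhs \<alpha> \<epsilon>' x (v x)) (at x)"
    and u_le: "\<And>x. u x \<le> - ln \<alpha>"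
    and v_bot: "(v \<longlongrightarrow> - ln \<alpha>) at_bot"
    and v_top: "((\<lambda>x. v x / exp (\<alpha> / 2 * x)) \<longlongrightarrow> 0) at_top"
  shows "u x \<le> v x"
proof (rule field_le_epsilon, rule ccontr)
  fix e :: real assume e: "e > 0" and neg: "\<not> u x \<le> v x + e"
  \<comment> \<open>scaled so that the barrier equals \<open>e\<close> at the point \<open>x\<close> in question\<close>
  define \<delta> where "\<delta> = e / exp (\<alpha> / 2 * x)"
  have \<delta>: "\<delta> > 0" using e by (simp add: \<delta>_def)
  define g where "g = (\<lambda>x. u x - v x - \<delta> * exp (\<alpha> / 2 * x))"
  define g' where "g' = (\<lambda>x. u' x - v' x - \<delta> * (\<alpha> / 2 * exp (\<alpha> / 2 * x)))"
  have gx: "g x > 0" using neg by (simp add: g_def \<delta>_def)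
  have dg: "(g has_real_derivative g' x) (at x)" for x
    unfolding g_def g'_def by (auto intro!: derivative_eq_intros u v)
  have dg': "(g' has_real_derivative painleve_rhs \<alpha> \<epsilon> x (u x) - painleve_rhs \<alpha> \<epsilon>' x (v x) - \<delta> * (\<alpha>\<^sup>2 / 4 * exp (\<alpha> / 2 * x))) (at x)" for x
    unfolding g'_def by (auto intro!: derivative_eq_intros u v simp: power2_eq_square)
  have "\<exists>x0. \<forall>y. g y \<le> g x0"
  proof (rule attains_max[of _ x])
    show "continuous_on UNIV g"
      using dg by (intro DERIV_continuous_on) (auto simp: has_field_derivative_at_within)
    have "((\<lambda>x. - ln \<alpha> / exp (\<alpha> / 2 * x)) \<longlongrightarrow> 0) at_top"
    proof (rule real_tendsto_divide_at_top[OF tendsto_const])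
      show "filterlim (\<lambda>x. exp (\<alpha> / 2 * x)) at_top at_top"
        using \<alpha> by (intro filterlim_compose[OF exp_at_top] filterlim_tendsto_pos_mult_at_top[OF tendsto_const] filterlim_ident) auto
    qed
    from tendsto_diff[OF this v_top]
    have "((\<lambda>x. - ln \<alpha> / exp (\<alpha> / 2 * x) - v x / exp (\<alpha> / 2 * x)) \<longlongrightarrow> 0) at_top" by simp
    then have "\<forall>\<^sub>F y in at_top. - ln \<alpha> / exp (\<alpha> / 2 * y) - v y / exp (\<alpha> / 2 * y) < \<delta>"
      using \<delta> by (rule order_tendstoD)
    then show "\<forall>\<^sub>F y in at_top. g y < g x"
    proof eventually_elim
      case (elim y)
      then have "(- ln \<alpha> - v y) / exp (\<alpha> / 2 * y) < \<delta>" by (simp only: diff_divide_distrib)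
      then have "- ln \<alpha> - v y < \<delta> * exp (\<alpha> / 2 * y)" by (simp add: divide_less_eq)
      then show ?case using u_le[of y] gx unfolding g_def by linarith
    qed
    have "\<forall>\<^sub>F y in at_bot. v y > - ln \<alpha> - g x"
      using v_bot gx by (intro order_tendstoD) auto
    then show "\<forall>\<^sub>F y in at_bot. g y < g x"
    proof eventually_elim
      case (elim y)
      have "\<delta> * exp (\<alpha> / 2 * y) > 0" using \<delta> by simp
      then show ?case using u_le[of y] elim unfolding g_def[THEN fun_cong, of y] by linarith
    qed
  qed
  then obtain x0 where x0: "\<And>y. g y \<le> g x0" by blast
  have g0: "g x0 > 0" using x0[of x] gx by simp
  then have d0: "u x0 - v x0 > \<delta> * exp (\<alpha> / 2 * x0)" by (simp add: g_def)
  moreover have pos: "\<delta> * exp (\<alpha> / 2 * x0) > 0" using \<delta> by simp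
  ultimately have "painleve_rhs \<alpha> \<epsilon> x0 (u x0) - painleve_rhs \<alpha> \<epsilon>' x0 (v x0) \<ge> \<alpha>\<^sup>2 * (u x0 - v x0)"
    using u_le by (intro painleve_rhs_monotone \<alpha> \<epsilon>) auto
  moreover have "\<alpha>\<^sup>2 * (u x0 - v x0) > \<alpha>\<^sup>2 * (\<delta> * exp (\<alpha> / 2 * x0))"
    using d0 \<alpha> by (intro mult_strict_left_mono) auto
  moreover have "\<alpha>\<^sup>2 * (\<delta> * exp (\<alpha> / 2 * x0)) \<ge> \<alpha>\<^sup>2 / 4 * (\<delta> * exp (\<alpha> / 2 * x0))"
    using pos by (intro mult_right_mono) auto
  moreover have "painleve_rhs \<alpha> \<epsilon> x0 (u x0) - painleve_rhs \<alpha> \<epsilon>' x0 (v x0) - \<delta> * (\<alpha>\<^sup>2 / 4 * exp (\<alpha> / 2 * x0)) \<le> 0"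
    by (rule second_derivative_at_max[OF dg dg' x0])
  ultimately show False by (simp add: algebra_simps)
qed

lemma derivative_integral:
  fixes f f' :: "real \<Rightarrow> real"
  assumes "\<And>x. (f has_real_derivative f' x) (at x)" "a \<le> b"
  shows "(f' has_integral (f b - f a)) {a..b}"
  using assms by (intro fundamental_theorem_of_calculus)
    (auto simp: has_real_derivative_iff_has_vector_derivative[symmetric] has_field_derivative_at_within)

text \<open>Pointwise convergence of \<open>u\<^sub>n\<close> and local bounds on \<open>u\<^sub>n''\<close> are enough.  Dominated convergence first makes
the increments of \<open>u\<^sub>n'\<close> converge, then \<open>u\<^sub>n'\<close> itself, because its mean over a unit
interval is an increment of \<open>u\<^sub>n\<close>; the limits are again related by integration.  Continuity of \<open>F\<close> is only
assumed as a consequence of that of \<open>U\<close>, since \<open>F\<close> is typically a function of \<open>U\<close>.\<close>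

lemma limit_second_order:
  fixes u v f :: "nat \<Rightarrow> real \<Rightarrow> real"
  assumes u: "\<And>n x. (u n has_real_derivative v n x) (at x)"
    and v: "\<And>n x. (v n has_real_derivative f n x) (at x)"
    and U: "\<And>x. (\<lambda>n. u n x) \<longlonglongrightarrow> U x"
    and F: "\<And>x. (\<lambda>n. f n x) \<longlonglongrightarrow> F x"
    and bound: "\<And>a b. \<exists>K. \<forall>n. \<forall>x\<in>{a..b}. \<bar>f n x\<bar> \<le> K"
    and cont: "continuous_on UNIV U \<Longrightarrow> continuous_on UNIV F"
  obtains V where "\<And>x. (\<lambda>n. v n x) \<longlonglongrightarrow> V x" "\<And>x. (U has_real_derivative V x) (at x)"
    "\<And>x. (V has_real_derivative F x) (at x)"
proof -
  have F_int: "F integrable_on {a..b}" "(\<lambda>n. v n b - v n a) \<longlonglongrightarrow> integral {a..b} F" if "a \<le> b" for a b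
  proof -
    obtain K where K: "\<And>n x. x \<in> {a..b} \<Longrightarrow> \<bar>f n x\<bar> \<le> K" using bound[of a b] by blast
    have fi: "(f n has_integral (v n b - v n a)) {a..b}" for n
      using v that by (rule derivative_integral)
    note dc = dominated_convergence[of f "{a..b}" "\<lambda>_. K" F]
    show "F integrable_on {a..b}" by (rule dc) (use fi K F in auto)
    have "(\<lambda>n. integral {a..b} (f n)) \<longlonglongrightarrow> integral {a..b} F" by (rule dc) (use fi K F in auto)
    then show "(\<lambda>n. v n b - v n a) \<longlonglongrightarrow> integral {a..b} F" by (simp add: integral_unique[OF fi])
  qed
  have v_diff: "convergent (\<lambda>n. v n b - v n a)" for a b
  proof (cases "a \<le> b")
    case True
    then show ?thesis using F_int(2) by (auto simp: convergent_def)
  next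
    case False
    then have "(\<lambda>n. - (v n a - v n b)) \<longlonglongrightarrow> - integral {b..a} F"
      by (intro tendsto_minus F_int) auto
    then show ?thesis by (auto simp: convergent_def)
  qed
  have v_diff_bound: "\<exists>K. \<forall>n. \<forall>x\<in>{a..b}. \<bar>v n x - v n a\<bar> \<le> K" for a b
  proof -
    obtain K where K: "\<And>n x. x \<in> {a..b} \<Longrightarrow> \<bar>f n x\<bar> \<le> K" using bound[of a b] by blast
    have "\<bar>v n x - v n a\<bar> \<le> \<bar>K\<bar> * (b - a)" if x: "x \<in> {a..b}" for n x
    proof -
      have "norm (v n x - v n a) \<le> \<bar>K\<bar> * norm (x - a)"
      proof (rule field_differentiable_bound[of "{a..b}" "v n" "f n"])
        show "norm (f n z) \<le> \<bar>K\<bar>" if "z \<in> {a..b}" for z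
          using K[OF that, of n] by simp
      qed (use v x in \<open>auto simp: has_field_derivative_at_within\<close>)
      also have "\<dots> \<le> \<bar>K\<bar> * (b - a)" using x by (intro mult_left_mono) auto
      finally show ?thesis by simp
    qed
    then show ?thesis by blast
  qed
  have v_conv: "convergent (\<lambda>n. v n a)" for a
  proof -
    obtain K where K: "\<And>n x. x \<in> {a..a+1} \<Longrightarrow> \<bar>v n x - v n a\<bar> \<le> K" using v_diff_bound[of a "a+1"] by blast
    define G where "G x = lim (\<lambda>n. v n x - v n a)" for x
    have G: "(\<lambda>n. v n x - v n a) \<longlonglongrightarrow> G x" for x
      unfolding G_def by (rule convergent_LIMSEQ_iff[THEN iffD1, OF v_diff])
    have vi: "((\<lambda>x. v n x - v n a) has_integral (u n (a + 1) - u n a - v n a)) {a..a+1}" for n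
      using has_integral_diff[OF derivative_integral[OF u, of a "a+1" n] has_integral_const_real[of "v n a" a "a+1"]] by simp
    have "(\<lambda>n. integral {a..a+1} (\<lambda>x. v n x - v n a)) \<longlonglongrightarrow> integral {a..a+1} G"
      by (rule dominated_convergence(2)[of _ _ "\<lambda>_. K"]) (use vi K G in auto)
    then have "(\<lambda>n. u n (a + 1) - u n a - v n a) \<longlonglongrightarrow> integral {a..a+1} G"
      by (simp add: integral_unique[OF vi])
    from tendsto_diff[OF tendsto_diff[OF U[of "a+1"] U[of a]] this]
    show ?thesis by (auto simp: convergent_def)
  qed
  define V where "V x = lim (\<lambda>n. v n x)" for x
  have V: "(\<lambda>n. v n x) \<longlonglongrightarrow> V x" for x
    unfolding V_def by (rule convergent_LIMSEQ_iff[THEN iffD1, OF v_conv])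
  have V_int: "V b = V a + integral {a..b} F" if "a \<le> b" for a b
    using LIMSEQ_unique[OF F_int(2)[OF that] tendsto_diff[OF V[of b] V[of a]]] by simp
  have V_cont: "continuous_on {a..b} V" for a b
  proof (cases "a \<le> b")
    case True
    \<comment> \<open>at this point only integrability of \<open>F\<close> is known, which suffices for continuity of \<open>V\<close>\<close>
    have "continuous_on {a..b} (\<lambda>x. V a + integral {a..x} F)"
      by (intro continuous_intros indefinite_integral_continuous_1 F_int True)
    then show ?thesis
      by (rule continuous_on_eq) (use V_int in auto)
  qed auto
  have U_int: "U b = U a + integral {a..b} V" if "a \<le> b" for a b
  proof -
    obtain K where K: "\<And>n x. x \<in> {a..b} \<Longrightarrow> \<bar>v n x - v n a\<bar> \<le> K" using v_diff_bound[of a b] by blast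
    obtain B where B: "\<And>n. \<bar>v n a\<bar> \<le> B"
      using convergent_imp_Bseq[OF v_conv[of a]] by (auto simp: Bseq_def)
    have vi: "(v n has_integral (u n b - u n a)) {a..b}" for n
      using u that by (rule derivative_integral)
    have "\<bar>v n x\<bar> \<le> K + B" if "x \<in> {a..b}" for n x
      using K[OF that, of n] B[of n] by linarith
    then have "(\<lambda>n. integral {a..b} (v n)) \<longlonglongrightarrow> integral {a..b} V"
      by (intro dominated_convergence(2)[of _ _ "\<lambda>_. K + B"]) (use vi V in auto)
    then have "(\<lambda>n. u n b - u n a) \<longlonglongrightarrow> integral {a..b} V"
      by (simp add: integral_unique[OF vi])
    from LIMSEQ_unique[OF this tendsto_diff[OF U[of b] U[of a]]] show ?thesis by simp
  qed
  have deriv: "(G has_real_derivative g x) (at x)"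
    if G: "\<And>a b. a \<le> b \<Longrightarrow> G b = G a + integral {a..b} g" and g: "\<And>a b. continuous_on {a..b} g" for G g :: "real \<Rightarrow> real" and x
  proof -
    have "((\<lambda>y. integral {x-1..y} g) has_real_derivative g x) (at x within {x-1..x+1})"
      by (rule integral_has_real_derivative) (use g in auto)
    then have "((\<lambda>y. integral {x-1..y} g) has_real_derivative g x) (at x)"
      by (simp add: at_within_Icc_at)
    then have "((\<lambda>y. G (x - 1) + integral {x-1..y} g) has_real_derivative g x) (at x)"
      by (auto intro!: derivative_eq_intros)
    then show ?thesis
      by (rule has_field_derivative_transform_within_open[of _ _ _ "{x-1<..<x+1}"]) (auto intro!: G[symmetric])
  qed
  have dU: "(U has_real_derivative V x) (at x)" for x
    using U_int V_cont by (rule deriv)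
  then have "continuous_on UNIV U"
    by (intro DERIV_continuous_on) (auto simp: has_field_derivative_at_within)
  then have "continuous_on {a..b} F" for a b
    using cont continuous_on_subset by blast
  with V_int have "(V has_real_derivative F x) (at x)" for x
    by (rule deriv)
  with V dU show ?thesis by (rule that)
qed

section \<open>The double scaling limit\<close>

definition "scale_factor \<alpha> n = 2 * real n + 1 + \<alpha>"
text \<open>The variable \<open>x = ln s\<close> moves the singularity of the equation at \<open>s = 0\<close> to \<open>- \<infinity>\<close>.\<close>

definition "log_C \<alpha> n x = ln (inv_mean \<alpha> n (exp x / scale_factor \<alpha> n))"
definition "log_C_slope \<alpha> n x = log_slope \<alpha> n (exp x / scale_factor \<alpha> n)"

lemma scaled_t_eq: "scaled_t s \<alpha> n = s / scale_factor \<alpha> n"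
  by (simp add: scaled_t_def scale_factor_def)

context
  fixes \<alpha> :: real
  assumes \<alpha>: "\<alpha> > 0"
begin

lemma scale_factor_pos: "scale_factor \<alpha> n > 0" "scale_factor \<alpha> n \<ge> 1" "scale_factor \<alpha> n \<noteq> 0"
  using \<alpha> by (simp_all add: scale_factor_def)

lemma scaled_pos: "exp x / scale_factor \<alpha> n > 0"
  using scale_factor_pos by simp

lemma scaled_deriv: "((\<lambda>x. exp x / scale_factor \<alpha> n) has_real_derivative exp x / scale_factor \<alpha> n) (at x)"
  using scale_factor_pos(3) by (auto intro!: derivative_eq_intros)

lemma inv_mean_eq_exp: "inv_mean \<alpha> n (exp x / scale_factor \<alpha> n) = exp (log_C \<alpha> n x)"
  using inv_mean_pos[OF \<alpha>, of "exp x / scale_factor \<alpha> n" n] scaled_pos[of x n] by (simp add: log_C_def)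

lemma log_C_deriv: "(log_C \<alpha> n has_real_derivative log_C_slope \<alpha> n x) (at x)"
proof -
  define t where "t = exp x / scale_factor \<alpha> n"
  have t: "t > 0" unfolding t_def by (rule scaled_pos)
  have Y: "inv_mean \<alpha> n t > 0" using t by (intro inv_mean_pos[OF \<alpha>]) simp
  have "((\<lambda>x. inv_mean \<alpha> n (exp x / scale_factor \<alpha> n)) has_real_derivative (inv_mean \<alpha> n t * log_slope \<alpha> n t / t) * t) (at x)"
    unfolding t_def by (rule DERIV_chain2[OF inv_mean_deriv[OF \<alpha> scaled_pos] scaled_deriv])
  also have "(inv_mean \<alpha> n t * log_slope \<alpha> n t / t) * t = inv_mean \<alpha> n t * log_slope \<alpha> n t" using t by simp
  finally have dY: "((\<lambda>x. inv_mean \<alpha> n (exp x / scale_factor \<alpha> n)) has_real_derivative inv_mean \<alpha> n t * log_slope \<alpha> n t) (at x)" .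
  have "((\<lambda>x. ln (inv_mean \<alpha> n (exp x / scale_factor \<alpha> n))) has_real_derivative
      1 / inv_mean \<alpha> n t * (inv_mean \<alpha> n t * log_slope \<alpha> n t)) (at x)"
    unfolding t_def by (rule DERIV_chain2[OF DERIV_ln_divide[OF Y[unfolded t_def]] dY[unfolded t_def]])
  then show ?thesis
    using Y unfolding log_C_def log_C_slope_def t_def[symmetric] by simp
qed

lemma log_C_slope_deriv:
  "(log_C_slope \<alpha> (Suc m) has_real_derivative painleve_rhs \<alpha> (1 / (scale_factor \<alpha> (Suc m))\<^sup>2) x (log_C \<alpha> (Suc m) x)) (at x)"
proof -
  define n where "n = Suc m"
  define N t Y where "N = scale_factor \<alpha> n" and "t = exp x / N" and "Y = inv_mean \<alpha> n t"
  have N: "N > 0" and t: "t > 0" using scale_factor_pos scaled_pos by (simp_all add: N_def t_def)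
  have Y: "Y = exp (log_C \<alpha> n x)" unfolding Y_def t_def N_def by (rule inv_mean_eq_exp)
  have "((\<lambda>x. log_slope \<alpha> n (exp x / N)) has_real_derivative ((N * (t * Y) + (t * Y)\<^sup>2 + \<alpha> / Y - 1 / Y\<^sup>2) / t) * t) (at x)"
    unfolding Y_def t_def N_def
    by (rule DERIV_chain2[OF log_slope_deriv[OF \<alpha> scaled_pos n_def, folded scale_factor_def] scaled_deriv])
  also have "((N * (t * Y) + (t * Y)\<^sup>2 + \<alpha> / Y - 1 / Y\<^sup>2) / t) * t = N * (t * Y) + (t * Y)\<^sup>2 + \<alpha> / Y - 1 / Y\<^sup>2"
    using t by simp
  also have "N * (t * Y) = exp (x + log_C \<alpha> n x)"
    using N by (simp add: t_def Y exp_add)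
  also have "t * Y = exp (x + log_C \<alpha> n x) / N"
    by (simp add: t_def Y exp_add)
  also have "\<alpha> / Y = \<alpha> * exp (- log_C \<alpha> n x)" by (simp add: Y exp_minus divide_inverse)
  also have "1 / Y\<^sup>2 = (exp (- log_C \<alpha> n x))\<^sup>2" by (simp add: Y exp_minus divide_inverse power_inverse)
  finally show ?thesis
    unfolding painleve_rhs_def log_C_slope_def n_def[symmetric] N_def[symmetric] by (simp add: power_divide)
qed

lemma log_C_le: "log_C \<alpha> n x \<le> - ln \<alpha>"
proof -
  have "log_C \<alpha> n x \<le> ln (1 / \<alpha>)"
    unfolding log_C_def
    by (rule ln_le_cancel_iff[THEN iffD2])
       (use \<alpha> scaled_pos[of x n] in \<open>auto intro!: inv_mean_pos inv_mean_le\<close>)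
  then show ?thesis using \<alpha> by (simp add: ln_div)
qed

lemma scaled_at_bot: "filterlim (\<lambda>x. exp x / scale_factor \<alpha> n) (at_right 0) at_bot"
proof -
  have "((\<lambda>x. exp x / scale_factor \<alpha> n) \<longlongrightarrow> 0 / scale_factor \<alpha> n) at_bot"
    using scale_factor_pos(3)[of n] by (intro tendsto_intros exp_at_bot) auto
  then show ?thesis
    by (auto simp: filterlim_at scale_factor_pos)
qed

lemma log_C_at_bot: "(log_C \<alpha> n \<longlongrightarrow> - ln \<alpha>) at_bot"
proof -
  have "((\<lambda>x. inv_mean \<alpha> n (exp x / scale_factor \<alpha> n)) \<longlongrightarrow> 1 / \<alpha>) at_bot"
    by (rule filterlim_compose[OF inv_mean_continuous_0[OF \<alpha>] scaled_at_bot])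
  then have "(log_C \<alpha> n \<longlongrightarrow> ln (1 / \<alpha>)) at_bot"
    unfolding log_C_def using \<alpha> by (intro tendsto_ln) auto
  then show ?thesis using \<alpha> by (simp add: ln_div)
qed

text \<open>By the Cauchy-Schwarz bound \<open>Y\<^sub>n\<close> decays at most like \<open>1 / t\<close>, that is, \<open>ln Y\<^sub>n\<close> is at least of order \<open>- x\<close>.\<close>

lemma log_C_lower:
  assumes "x \<ge> 0"
  shows "- ln (scale_factor \<alpha> n + 1 / \<alpha>) - x \<le> log_C \<alpha> n x"
proof -
  define N t Y where "N = scale_factor \<alpha> n" and "t = exp x / N" and "Y = inv_mean \<alpha> n t"
  have N: "N \<ge> 1" and t: "t > 0" using scale_factor_pos scaled_pos by (simp_all add: N_def t_def)
  have Y: "Y > 0" "Y \<le> 1 / \<alpha>" unfolding Y_def using t by (auto intro!: inv_mean_pos inv_mean_le \<alpha>)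
  have "t * Y \<le> exp x * (1 / \<alpha>)"
    using N Y t \<alpha> unfolding t_def by (intro mult_mono) (auto simp: field_simps)
  moreover have "N \<le> N * exp x" using N assms by (simp add: mult_le_cancel_left1)
  ultimately have le: "N + t * Y \<le> (N + 1 / \<alpha>) * exp x" by (simp add: algebra_simps)
  have "1 \<le> (N + t * Y) * Y"
    using inv_mean_lower[OF \<alpha>, of t n] t by (simp add: N_def Y_def scale_factor_def)
  also have "\<dots> \<le> (N + 1 / \<alpha>) * exp x * Y" using le Y by (intro mult_right_mono) auto
  finally have "ln 1 \<le> ln ((N + 1 / \<alpha>) * exp x * Y)" by (subst ln_le_cancel_iff) auto
  moreover have "N + 1 / \<alpha> > 0" using N \<alpha> by (simp add: add_pos_pos)
  ultimately show ?thesis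
    using Y(1) by (simp add: log_C_def ln_mult flip: N_def t_def Y_def)
qed

lemma log_C_at_top: "((\<lambda>x. log_C \<alpha> n x / exp (\<alpha> / 2 * x)) \<longlongrightarrow> 0) at_top"
proof (rule tendsto_sandwich)
  define c where "c = - ln (scale_factor \<alpha> n + 1 / \<alpha>)"
  show "((\<lambda>x. (c - x) / exp (\<alpha> / 2 * x)) \<longlongrightarrow> 0) at_top"
    using \<alpha> by real_asymp
  show "((\<lambda>x. - ln \<alpha> / exp (\<alpha> / 2 * x)) \<longlongrightarrow> 0) at_top"
    using \<alpha> by real_asymp
  show "\<forall>\<^sub>F x in at_top. (c - x) / exp (\<alpha> / 2 * x) \<le> log_C \<alpha> n x / exp (\<alpha> / 2 * x)"
    using eventually_ge_at_top[of 0]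
    by eventually_elim (use log_C_lower in \<open>auto simp: c_def divide_right_mono\<close>)
  show "\<forall>\<^sub>F x in at_top. log_C \<alpha> n x / exp (\<alpha> / 2 * x) \<le> - ln \<alpha> / exp (\<alpha> / 2 * x)"
    by (intro always_eventually allI divide_right_mono log_C_le) auto
qed

text \<open>The maximum principle applies because \<open>\<epsilon> = (2n + 1 + \<alpha>)\<^sup>-\<^sup>2\<close> decreases with \<open>n\<close>.  The indices start
at \<open>1\<close> since the equation for \<open>R\<^sub>n\<close> was derived with the help of \<open>P\<^sub>n\<^sub>-\<^sub>1\<close>.\<close>

lemma log_C_mono: "m \<le> n \<Longrightarrow> log_C \<alpha> (Suc m) x \<le> log_C \<alpha> (Suc n) x"
proof (rule painleve_rhs_comparison[OF \<alpha> _ _ log_C_deriv log_C_slope_deriv log_C_deriv log_C_slope_deriv log_C_le log_C_at_bot log_C_at_top])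
  assume "m \<le> n"
  then have "scale_factor \<alpha> (Suc m) \<le> scale_factor \<alpha> (Suc n)" by (simp add: scale_factor_def)
  then show "1 / (scale_factor \<alpha> (Suc n))\<^sup>2 \<le> 1 / (scale_factor \<alpha> (Suc m))\<^sup>2"
    using scale_factor_pos[of "Suc m"] by (intro divide_left_mono power_mono) auto
qed auto

lemma log_C_limit:
  obtains U V where "\<And>x. (\<lambda>n. log_C \<alpha> (Suc n) x) \<longlonglongrightarrow> U x" "\<And>x. (\<lambda>n. log_C_slope \<alpha> (Suc n) x) \<longlonglongrightarrow> V x"
    "\<And>x. (U has_real_derivative V x) (at x)" "\<And>x. (V has_real_derivative painleve_rhs \<alpha> 0 x (U x)) (at x)"
    "(U \<longlongrightarrow> - ln \<alpha>) at_bot"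
proof -
  define U where "U x = lim (\<lambda>n. log_C \<alpha> (Suc n) x)" for x
  have U: "(\<lambda>n. log_C \<alpha> (Suc n) x) \<longlonglongrightarrow> U x" for x
  proof -
    have "incseq (\<lambda>n. log_C \<alpha> (Suc n) x)" using log_C_mono by (auto simp: incseq_def)
    then obtain L where "(\<lambda>n. log_C \<alpha> (Suc n) x) \<longlonglongrightarrow> L"
      using incseq_convergent[of _ "- ln \<alpha>"] log_C_le by metis
    then show ?thesis unfolding U_def by (simp add: limI)
  qed
  \<comment> \<open>the first member of the sequence keeps the limit from falling away from \<open>- ln \<alpha>\<close> at \<open>- \<infinity>\<close>\<close>
  have U_ge: "log_C \<alpha> 1 x \<le> U x" for x
    by (rule LIMSEQ_le_const[OF U]) (use log_C_mono[of 0] in auto)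
  have U_le: "U x \<le> - ln \<alpha>" for x
    by (rule LIMSEQ_le_const2[OF U]) (use log_C_le in auto)
  have U_bot: "(U \<longlongrightarrow> - ln \<alpha>) at_bot"
    by (rule tendsto_sandwich[OF _ _ log_C_at_bot[of 1] tendsto_const])
       (rule always_eventually, rule allI, rule U_ge U_le)+
  let ?\<epsilon> = "\<lambda>n. 1 / (scale_factor \<alpha> (Suc n))\<^sup>2"
  have eps: "?\<epsilon> \<longlonglongrightarrow> 0"
    unfolding scale_factor_def by real_asymp
  have F: "(\<lambda>n. painleve_rhs \<alpha> (?\<epsilon> n) x (log_C \<alpha> (Suc n) x)) \<longlonglongrightarrow> painleve_rhs \<alpha> 0 x (U x)" for x
    unfolding painleve_rhs_def by (intro tendsto_intros U eps)
  have bound: "\<exists>K. \<forall>n. \<forall>x\<in>{a..b}. \<bar>painleve_rhs \<alpha> (?\<epsilon> n) x (log_C \<alpha> (Suc n) x)\<bar> \<le> K" for a b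
  proof -
    have "continuous_on {a..b} (log_C \<alpha> 1)"
      by (intro DERIV_continuous_on[of _ _ "log_C_slope \<alpha> 1"]) (simp add: has_field_derivative_at_within log_C_deriv)
    then have "bounded (log_C \<alpha> 1 ` {a..b})"
      by (intro compact_imp_bounded compact_continuous_image) auto
    then obtain L where "\<forall>y\<in>log_C \<alpha> 1 ` {a..b}. norm y \<le> L"
      unfolding bounded_iff by blast
    then have L: "\<bar>log_C \<alpha> 1 x\<bar> \<le> L" if "x \<in> {a..b}" for x
      using that by auto
    define A B where "A = exp (b - ln \<alpha>)" and "B = exp L"
    have "\<bar>painleve_rhs \<alpha> (?\<epsilon> n) x (log_C \<alpha> (Suc n) x)\<bar> \<le> A + 1 * A\<^sup>2 + \<alpha> * B + B\<^sup>2" if x: "x \<in> {a..b}" for n x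
    proof -
      let ?u = "log_C \<alpha> (Suc n) x"
      have A: "exp (x + ?u) \<le> A" using x log_C_le[of "Suc n" x] by (simp add: A_def)
      have B: "exp (- ?u) \<le> B" using L[OF x] log_C_mono[of 0 n x] by (simp add: B_def)
      have "?\<epsilon> n \<le> 1" using scale_factor_pos(2)[of "Suc n"] by (simp add: power_le_one_iff field_simps)
      then have 1: "?\<epsilon> n * (exp (x + ?u))\<^sup>2 \<le> 1 * A\<^sup>2" using A by (intro mult_mono power_mono) auto
      have 2: "\<alpha> * exp (- ?u) \<le> \<alpha> * B" using B \<alpha> by (intro mult_left_mono) auto
      have 3: "(exp (- ?u))\<^sup>2 \<le> B\<^sup>2" using B by (intro power_mono) auto
      have "0 \<le> ?\<epsilon> n * (exp (x + ?u))\<^sup>2" "0 \<le> \<alpha> * exp (- ?u)" "0 \<le> (exp (- ?u))\<^sup>2" "0 \<le> exp (x + ?u)"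
        using \<alpha> by auto
      with 1 2 3 A show ?thesis unfolding painleve_rhs_def by linarith
    qed
    then show ?thesis by blast
  qed
  have cont: "continuous_on UNIV U \<Longrightarrow> continuous_on UNIV (\<lambda>x. painleve_rhs \<alpha> 0 x (U x))"
    unfolding painleve_rhs_def by (intro continuous_intros)
  show ?thesis
    by (rule limit_second_order[OF log_C_deriv log_C_slope_deriv U F bound cont], assumption) (rule that[OF U _ _ _ U_bot])
qed

text \<open>Each of the \<open>n\<close> summands \<open>t Y\<^sub>j\<close> is at most \<open>t / \<alpha>\<close>, and \<open>n t \<le> s\<close>.  The bound does not depend on \<open>n\<close>, so
it also controls the limit near \<open>s = 0\<close>.\<close>

lemma log_deriv_H_bound:
  assumes "s \<ge> 0"
  shows "\<bar>log_deriv_H n (scaled_t s \<alpha> n) \<alpha>\<bar> \<le> s / \<alpha>"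
proof -
  let ?N = "scale_factor \<alpha> n" and ?t = "scaled_t s \<alpha> n"
  have t: "?t \<ge> 0" using assms scale_factor_pos[of n] by (simp add: scaled_t_eq)
  have "0 \<le> (\<Sum>j<n. inv_mean \<alpha> j ?t)" using inv_mean_pos[OF \<alpha> t] by (intro sum_nonneg) (simp add: less_imp_le)
  moreover have "?t * (\<Sum>j<n. inv_mean \<alpha> j ?t) \<le> ?t * (?N / \<alpha>)"
  proof (rule mult_left_mono[OF _ t])
    have "(\<Sum>j<n. inv_mean \<alpha> j ?t) \<le> (\<Sum>j<n. 1 / \<alpha>)" using inv_mean_le[OF \<alpha> t] by (intro sum_mono) auto
    also have "\<dots> \<le> ?N / \<alpha>" using \<alpha> by (simp add: scale_factor_def divide_right_mono)
    finally show "(\<Sum>j<n. inv_mean \<alpha> j ?t) \<le> ?N / \<alpha>" .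
  qed
  ultimately have "\<bar>log_deriv_H n ?t \<alpha>\<bar> \<le> ?t * (?N / \<alpha>)"
    using t by (simp add: log_deriv_H_eq[OF \<alpha> t] abs_mult)
  then show ?thesis using scale_factor_pos[of n] by (simp add: scaled_t_eq)
qed

text \<open>At \<open>x = 0\<close> the integrand is \<open>0 / 0 = 0\<close>, which does not affect the integral.\<close>

lemma log_hankel_has_integral:
  assumes s: "s \<ge> 0"
  shows "((\<lambda>x. log_deriv_H n (scaled_t x \<alpha> n) \<alpha> / x) has_integral
     ln (hankel_det n (scaled_t s \<alpha> n) \<alpha> / hankel_det n 0 \<alpha>)) {0..s}"
proof -
  let ?N = "scale_factor \<alpha> n"
  define f where "f = (\<lambda>u. ln (hankel_det n u \<alpha> / hankel_det n 0 \<alpha>))"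
  have d: "((\<lambda>x. f (scaled_t x \<alpha> n)) has_real_derivative - (\<Sum>j<n. inv_mean \<alpha> j (scaled_t x \<alpha> n)) * (1 / ?N)) (at x within {0..})"
    if "x \<ge> 0" for x
  proof -
    have "(f has_real_derivative - (\<Sum>j<n. inv_mean \<alpha> j (scaled_t x \<alpha> n))) (at (scaled_t x \<alpha> n) within {0..})"
      unfolding f_def using that scale_factor_pos[of n] by (intro log_hankel_deriv[OF \<alpha>]) (simp add: scaled_t_eq)
    then have "(f has_real_derivative - (\<Sum>j<n. inv_mean \<alpha> j (scaled_t x \<alpha> n))) (at (scaled_t x \<alpha> n) within (\<lambda>x. scaled_t x \<alpha> n) ` {0..})"
      by (rule has_field_derivative_subset) (use scale_factor_pos[of n] in \<open>auto simp: scaled_t_eq\<close>)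
    moreover have "((\<lambda>x. scaled_t x \<alpha> n) has_real_derivative 1 / ?N) (at x within {0..})"
      unfolding scaled_t_eq using scale_factor_pos(3) by (auto intro!: derivative_eq_intros)
    ultimately show ?thesis
      using DERIV_image_chain unfolding o_def by fast
  qed
  have "((\<lambda>x. log_deriv_H n (scaled_t x \<alpha> n) \<alpha> / x) has_integral f (scaled_t s \<alpha> n) - f (scaled_t 0 \<alpha> n)) {0..s}"
  proof (rule fundamental_theorem_of_calculus_interior[OF s])
    show "continuous_on {0..s} (\<lambda>x. f (scaled_t x \<alpha> n))"
      by (rule DERIV_continuous_on, rule has_field_derivative_subset[OF d]) auto
    fix x assume x: "x \<in> {0<..<s}"
    have "- (\<Sum>j<n. inv_mean \<alpha> j (scaled_t x \<alpha> n)) * (1 / ?N) = log_deriv_H n (scaled_t x \<alpha> n) \<alpha> / x"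
      using x scale_factor_pos[of n] by (subst log_deriv_H_eq[OF \<alpha>]) (auto simp: scaled_t_eq)
    then show "((\<lambda>x. f (scaled_t x \<alpha> n)) has_vector_derivative log_deriv_H n (scaled_t x \<alpha> n) \<alpha> / x) (at x)"
      using d[of x] x at_within_nonneg[OF \<alpha>, of x] by (simp add: has_real_derivative_iff_has_vector_derivative)
  qed
  moreover have "f (scaled_t 0 \<alpha> n) = 0"
    using hankel_ratio_pos[OF \<alpha>, of 0 n]
    by (cases "hankel_det n 0 \<alpha> = 0") (simp_all add: f_def scaled_t_eq)
  ultimately show ?thesis by (simp add: f_def)
qed

end

theorem theorem4:
  fixes \<alpha> :: real and \<Delta> C H :: "real \<Rightarrow> real"
  assumes "\<alpha> > 0"
  defines "\<Delta> \<equiv> Delta_lim \<alpha>" and "C \<equiv> C_lim \<alpha>" and "H \<equiv> H_lim \<alpha>"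
  shows
    \<comment> \<open>the limits exist\<close>
    "(\<forall>s\<ge>0. (\<lambda>n. hankel_det n (scaled_t s \<alpha> n) \<alpha> / hankel_det n 0 \<alpha>) \<longlonglongrightarrow> \<Delta> s) \<and>
     (\<forall>s>0. (\<lambda>n. aux_y n (scaled_t s \<alpha> n) \<alpha> / scaled_t s \<alpha> n) \<longlonglongrightarrow> C s) \<and>
     (\<forall>s\<ge>0. (\<lambda>n. log_deriv_H n (scaled_t s \<alpha> n) \<alpha>) \<longlonglongrightarrow> H s) \<and>
     \<Delta> 0 = 1 \<and> (\<Delta> \<longlongrightarrow> 1) (at_right 0) \<and>
     (\<forall>s>0. C differentiable (at s) \<and> deriv C differentiable (at s) \<and> C s \<noteq> 0 \<and>
        deriv (deriv C) s =
          (deriv C s)\<^sup>2 / C s - deriv C s / s + (C s)\<^sup>2 / s + \<alpha> / s\<^sup>2 - 1 / (s\<^sup>2 * C s)) \<and>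
     (C \<longlongrightarrow> 1 / \<alpha>) (at_right 0) \<and>
     (\<forall>s>0. \<Delta> s > 0 \<and> \<Delta> differentiable (at s) \<and> H s = s * deriv (\<lambda>u. ln (\<Delta> u)) s) \<and>
     (\<forall>s>0. H differentiable (at s) \<and> deriv H differentiable (at s) \<and>
        (s * deriv (deriv H) s)\<^sup>2 + 4 * (deriv H s)\<^sup>2 * (s * deriv H s - H s)
          - (\<alpha> * deriv H s + 1 / 2)\<^sup>2 = 0) \<and>
     H 0 = 0 \<and> (H \<longlongrightarrow> 0) (at_right 0) \<and>
     (\<forall>s>0. H s = 1 / 4 * (s * deriv C s / C s)\<^sup>2 - s * C s / 2 - 1 / 4 * (1 / C s - \<alpha>)\<^sup>2)"
proof -
  note \<alpha> = assms(1)
  obtain U V where U: "\<And>x. (\<lambda>n. log_C \<alpha> (Suc n) x) \<longlonglongrightarrow> U x" and V: "\<And>x. (\<lambda>n. log_C_slope \<alpha> (Suc n) x) \<longlonglongrightarrow> V x"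
    and dU: "\<And>x. (U has_real_derivative V x) (at x)" and dV: "\<And>x. (V has_real_derivative painleve_rhs \<alpha> 0 x (U x)) (at x)"
    and U_bot: "(U \<longlongrightarrow> - ln \<alpha>) at_bot"
    using log_C_limit[OF \<alpha>] by metis
  \<comment> \<open>\<open>c\<close>, \<open>v\<close> and \<open>k\<close> turn out to be \<open>C\<close>, \<open>s C' / C\<close> and \<open>H\<close> for positive arguments\<close>
  define c where "c = (\<lambda>s. exp (U (ln s)))"
  define v where "v = (\<lambda>s. V (ln s))"
  define k where "k = (\<lambda>s. 1 / 4 * (v s)\<^sup>2 - s * c s / 2 - 1 / 4 * (1 / c s - \<alpha>)\<^sup>2)"
  note N_pos = scale_factor_pos[OF \<alpha>]
  have c_pos: "c s > 0" for s by (simp add: c_def)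

  have Y_lim: "(\<lambda>n. inv_mean \<alpha> n (scaled_t s \<alpha> n)) \<longlonglongrightarrow> c s" if s: "s > 0" for s
  proof (rule LIMSEQ_imp_Suc)
    have "(\<lambda>n. exp (log_C \<alpha> (Suc n) (ln s))) \<longlonglongrightarrow> c s"
      unfolding c_def by (intro tendsto_intros U)
    then show "(\<lambda>n. inv_mean \<alpha> (Suc n) (scaled_t s \<alpha> (Suc n))) \<longlonglongrightarrow> c s"
      using s by (simp add: scaled_t_eq flip: inv_mean_eq_exp[OF \<alpha>])
  qed
  have t_lim: "scaled_t s \<alpha> \<longlonglongrightarrow> 0" for s
    unfolding scaled_t_def by real_asymp
  have C_conv: "(\<lambda>n. aux_y n (scaled_t s \<alpha> n) \<alpha> / scaled_t s \<alpha> n) \<longlonglongrightarrow> c s" if s: "s > 0" for s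
  proof -
    have "scaled_t s \<alpha> n > 0" for n using s N_pos by (simp add: scaled_t_eq)
    then have "aux_y n (scaled_t s \<alpha> n) \<alpha> / scaled_t s \<alpha> n = inv_mean \<alpha> n (scaled_t s \<alpha> n)" for n
      by (simp add: aux_y_eq[OF \<alpha>] less_imp_le less_imp_neq[symmetric])
    then show ?thesis using Y_lim[OF s] by simp
  qed
  have H_conv: "(\<lambda>n. log_deriv_H n (scaled_t s \<alpha> n) \<alpha>) \<longlonglongrightarrow> k s" if s: "s > 0" for s
  proof (rule LIMSEQ_imp_Suc)
    let ?t = "\<lambda>n. scaled_t s \<alpha> (Suc n)" and ?Y = "\<lambda>n. inv_mean \<alpha> (Suc n) (scaled_t s \<alpha> (Suc n))"
    have t: "?t n > 0" for n using s N_pos by (simp add: scaled_t_eq)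
    have eq: "log_deriv_H (Suc n) (?t n) \<alpha> = 1 / 4 * (log_C_slope \<alpha> (Suc n) (ln s))\<^sup>2 - (s - ?t n) * ?Y n / 2
        - (?t n * ?Y n)\<^sup>2 / 4 - 1 / 4 * (1 / ?Y n - \<alpha>)\<^sup>2 + ?t n / 2" for n
    proof -
      have "(2 * real (Suc n) + \<alpha>) * ?t n = s - ?t n"
        using N_pos(3)[of "Suc n"] by (simp add: scaled_t_eq scale_factor_def field_simps)
      then have "(2 * real (Suc n) + \<alpha>) * (?t n * ?Y n) = (s - ?t n) * ?Y n"
        by (simp only: mult.assoc[symmetric])
      moreover have "log_slope \<alpha> (Suc n) (?t n) = log_C_slope \<alpha> (Suc n) (ln s)"
        using s by (simp add: log_C_slope_def scaled_t_eq)
      ultimately show ?thesis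
        using log_deriv_H_closed_form[OF \<alpha> t refl, of n] by simp
    qed
    have tl: "?t \<longlonglongrightarrow> 0" and Yl: "?Y \<longlonglongrightarrow> c s"
      using t_lim[of s] Y_lim[OF s] by (auto intro: LIMSEQ_Suc)
    have "(\<lambda>n. 1 / 4 * (log_C_slope \<alpha> (Suc n) (ln s))\<^sup>2 - (s - ?t n) * ?Y n / 2
        - (?t n * ?Y n)\<^sup>2 / 4 - 1 / 4 * (1 / ?Y n - \<alpha>)\<^sup>2 + ?t n / 2) \<longlonglongrightarrow>
        1 / 4 * (v s)\<^sup>2 - (s - 0) * c s / 2 - (0 * c s)\<^sup>2 / 4 - 1 / 4 * (1 / c s - \<alpha>)\<^sup>2 + 0 / 2"
      unfolding v_def using c_pos[of s] by (intro tendsto_intros V tl Yl) auto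
    then show "(\<lambda>n. log_deriv_H (Suc n) (?t n) \<alpha>) \<longlonglongrightarrow> k s"
      unfolding eq k_def by simp
  qed
  have H0: "(\<lambda>n. log_deriv_H n (scaled_t 0 \<alpha> n) \<alpha>) \<longlonglongrightarrow> 0"
    by (simp add: scaled_t_def log_deriv_H_def)
  have C_eq: "C s = c s" if "s > 0" for s
    using C_conv[OF that] by (simp add: C_def C_lim_def limI)
  have H_eq: "H s = k s" if "s > 0" for s
    using H_conv[OF that] by (simp add: H_def H_lim_def limI)
  have H_0: "H 0 = 0"
    using H0 by (simp add: H_def H_lim_def limI)
  have H_lim: "(\<lambda>n. log_deriv_H n (scaled_t s \<alpha> n) \<alpha>) \<longlonglongrightarrow> H s" if "s \<ge> 0" for s
    using H_conv[of s] H_eq[of s] H0 H_0 that by (cases "s = 0") auto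
  have H_bound: "\<bar>H s\<bar> \<le> s / \<alpha>" if "s \<ge> 0" for s
    by (rule LIMSEQ_le_const2[OF tendsto_rabs[OF H_lim[OF that]]])
       (use log_deriv_H_bound[OF \<alpha> that] in auto)

  have dc: "(c has_real_derivative c s * v s / s) (at s)" if "s > 0" for s
    unfolding c_def v_def using that by (auto intro!: derivative_eq_intros DERIV_chain2[OF dU])
  have dv: "(v has_real_derivative (s * c s + \<alpha> / c s - 1 / (c s)\<^sup>2) / s) (at s)" if "s > 0" for s
  proof -
    have "(v has_real_derivative painleve_rhs \<alpha> 0 (ln s) (U (ln s)) * (1 / s)) (at s)"
      unfolding v_def by (rule DERIV_chain2[OF dV DERIV_ln_divide[OF that]])
    then show ?thesis
      using that by (simp add: painleve_rhs_def c_def exp_add exp_minus divide_inverse power_inverse)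
  qed
  \<comment> \<open>by the equation for \<open>v\<close> only the explicit dependence of \<open>k\<close> on \<open>s\<close> contributes to the derivative\<close>
  have dk: "(k has_real_derivative - c s / 2) (at s)" if s: "s > 0" for s
  proof -
    have "(k has_real_derivative 1 / 4 * (2 * v s * ((s * c s + \<alpha> / c s - 1 / (c s)\<^sup>2) / s))
        - (c s + s * (c s * v s / s)) / 2 - 1 / 4 * (2 * (1 / c s - \<alpha>) * (- (c s * v s / s) / (c s)\<^sup>2))) (at s)"
      unfolding k_def using s c_pos[of s]
      by (auto intro!: derivative_eq_intros dc dv simp: power2_eq_square, simp add: field_simps)
    also have "1 / 4 * (2 * v s * ((s * c s + \<alpha> / c s - 1 / (c s)\<^sup>2) / s))
        - (c s + s * (c s * v s / s)) / 2 - 1 / 4 * (2 * (1 / c s - \<alpha>) * (- (c s * v s / s) / (c s)\<^sup>2)) = - c s / 2"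
      using s c_pos[of s] by (simp add: field_simps power2_eq_square)
    finally show ?thesis .
  qed
  have dC: "(C has_real_derivative C s * v s / s) (at s)" if "s > 0" for s
  proof -
    have "(C has_real_derivative c s * v s / s) (at s)"
      by (rule has_field_derivative_transform_within_open[OF dc[OF that], of "{0<..}"]) (use that C_eq in auto)
    then show ?thesis using C_eq[OF that] by simp
  qed
  have deriv_C: "deriv C s = C s * v s / s" if "s > 0" for s
    using dC[OF that] by (rule DERIV_imp_deriv)
  have ddC: "(deriv C has_real_derivative ((C s * v s / s * v s + (s * C s + \<alpha> / C s - 1 / (C s)\<^sup>2) / s * C s) * s
      - C s * v s) / (s * s)) (at s)" if s: "s > 0" for s
  proof -
    have dv': "(v has_real_derivative (s * C s + \<alpha> / C s - 1 / (C s)\<^sup>2) / s) (at s)"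
      unfolding C_eq[OF s] by (rule dv[OF s])
    have "((\<lambda>s. C s * v s / s) has_real_derivative
       ((C s * v s / s * v s + (s * C s + \<alpha> / C s - 1 / (C s)\<^sup>2) / s * C s) * s - C s * v s * 1) / (s * s)) (at s)"
      by (rule DERIV_divide[OF DERIV_mult[OF dC[OF s] dv'] DERIV_ident]) (use s in simp)
    then have "((\<lambda>s. C s * v s / s) has_real_derivative
       ((C s * v s / s * v s + (s * C s + \<alpha> / C s - 1 / (C s)\<^sup>2) / s * C s) * s - C s * v s) / (s * s)) (at s)"
      by (simp only: mult_1_right)
    then show ?thesis
      by (rule has_field_derivative_transform_within_open[of _ _ _ "{0<..}"]) (use s deriv_C in simp_all)
  qed
  have dH: "(H has_real_derivative - C s / 2) (at s)" if s: "s > 0" for s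
  proof -
    have "(H has_real_derivative - c s / 2) (at s)"
      by (rule has_field_derivative_transform_within_open[OF dk[OF s], of "{0<..}"]) (use s H_eq in auto)
    then show ?thesis using C_eq[OF s] by simp
  qed
  have deriv_H: "deriv H s = - C s / 2" if "s > 0" for s
    using dH[OF that] by (rule DERIV_imp_deriv)
  have ddH: "(deriv H has_real_derivative - (C s * v s / s) / 2) (at s)" if s: "s > 0" for s
  proof -
    have "((\<lambda>s. - C s / 2) has_real_derivative - (C s * v s / s) / 2) (at s)"
      by (rule DERIV_cdivide[OF DERIV_minus[OF dC[OF s]]])
    then show ?thesis
      by (rule has_field_derivative_transform_within_open[of _ _ _ "{0<..}"]) (use s deriv_H in simp_all)
  qed

  define g where "g = (\<lambda>x. H x / x)"
  have conv: "g integrable_on {0..s}"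
    "(\<lambda>n. ln (hankel_det n (scaled_t s \<alpha> n) \<alpha> / hankel_det n 0 \<alpha>)) \<longlonglongrightarrow> integral {0..s} g"
    if s: "s \<ge> 0" for s
  proof -
    let ?f = "\<lambda>n x. log_deriv_H n (scaled_t x \<alpha> n) \<alpha> / x"
    note hi = log_hankel_has_integral[OF \<alpha> s]
    have bound: "norm (?f n x) \<le> 1 / \<alpha>" if "x \<in> {0..s}" for n x
    proof (cases "x = 0")
      case False
      then have x: "x > 0" using that by simp
      have "norm (?f n x) = \<bar>log_deriv_H n (scaled_t x \<alpha> n) \<alpha>\<bar> / x" using x by simp
      also have "\<dots> \<le> (x / \<alpha>) / x" using log_deriv_H_bound[OF \<alpha>, of x n] x by (intro divide_right_mono) auto
      finally show ?thesis using x by simp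
    qed (use \<alpha> in simp)
    have lim: "(\<lambda>n. ?f n x) \<longlonglongrightarrow> g x" if "x \<in> {0..s}" for x
    proof (cases "x = 0")
      case False
      then show ?thesis
        unfolding g_def using that by (intro tendsto_divide H_lim tendsto_const) auto
    qed (simp add: g_def)
    have int: "?f n integrable_on {0..s}" for n
      using hi by (rule has_integral_integrable)
    have const: "(\<lambda>_. 1 / \<alpha>) integrable_on {0..s}" by (rule integrable_const_ivl)
    show "g integrable_on {0..s}"
      by (rule dominated_convergence(1)[OF int const bound lim])
    have "(\<lambda>n. integral {0..s} (?f n)) \<longlonglongrightarrow> integral {0..s} g"
      by (rule dominated_convergence(2)[OF int const bound lim])
    then show "(\<lambda>n. ln (hankel_det n (scaled_t s \<alpha> n) \<alpha> / hankel_det n 0 \<alpha>)) \<longlonglongrightarrow> integral {0..s} g"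
      by (simp add: integral_unique[OF hi])
  qed
  have D_conv: "(\<lambda>n. hankel_det n (scaled_t s \<alpha> n) \<alpha> / hankel_det n 0 \<alpha>) \<longlonglongrightarrow> exp (integral {0..s} g)" if s: "s \<ge> 0" for s
  proof -
    have "hankel_det n (scaled_t s \<alpha> n) \<alpha> / hankel_det n 0 \<alpha> > 0" for n
      using s N_pos by (intro hankel_ratio_pos[OF \<alpha>]) (simp add: scaled_t_eq less_imp_le)
    then show ?thesis using tendsto_exp[OF conv(2)[OF s]] by simp
  qed
  have D_eq: "\<Delta> s = exp (integral {0..s} g)" if "s \<ge> 0" for s
    using D_conv[OF that] by (simp add: \<Delta>_def Delta_lim_def limI)
  have dI: "((\<lambda>s. integral {0..s} g) has_real_derivative g s) (at s)" if s: "s > 0" for s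
  proof -
    have "isCont g s"
      unfolding g_def using s DERIV_isCont[OF dH[OF s]] by (intro continuous_intros) auto
    then have "continuous (at s within ({0..s+1} - {})) g"
      by (rule continuous_at_imp_continuous_at_within)
    from integral_has_vector_derivative_continuous_at[OF conv(1) _ _ this]
    have "((\<lambda>s. integral {0..s} g) has_real_derivative g s) (at s within {0..s+1})"
      using s by (simp add: has_real_derivative_iff_has_vector_derivative)
    then show ?thesis using s by (simp add: at_within_Icc_at)
  qed
  have dD: "(\<Delta> has_real_derivative exp (integral {0..s} g) * g s) (at s)" if s: "s > 0" for s
    by (rule has_field_derivative_transform_within_open[OF DERIV_fun_exp[OF dI[OF s]], of "{0<..}"])
       (use s D_eq in auto)
  have dlnD: "deriv (\<lambda>u. ln (\<Delta> u)) s = g s" if s: "s > 0" for s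
    by (intro DERIV_imp_deriv has_field_derivative_transform_within_open[OF dI[OF s], of "{0<..}"])
       (use s D_eq in auto)
  have D_at_0: "(\<Delta> \<longlongrightarrow> 1) (at_right 0)"
  proof -
    have "continuous_on {0..1} (\<lambda>s. integral {0..s} g)"
      by (intro indefinite_integral_continuous_1 conv) auto
    then have "((\<lambda>s. integral {0..s} g) \<longlongrightarrow> integral {0..0} g) (at 0 within {0..1})"
      unfolding continuous_on_def by (rule bspec) simp
    then have "((\<lambda>s. exp (integral {0..s} g)) \<longlongrightarrow> exp 0) (at_right 0)"
      by (intro tendsto_exp) (simp add: at_within_Icc_at_right)
    moreover have "\<forall>\<^sub>F s in at_right 0. \<Delta> s = exp (integral {0..s} g)"
      using D_eq by (auto simp: eventually_at_filter)
    ultimately show ?thesis by (simp add: tendsto_cong)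
  qed
  have C_at_0: "(C \<longlongrightarrow> 1 / \<alpha>) (at_right 0)"
  proof -
    have "(c \<longlongrightarrow> exp (- ln \<alpha>)) (at_right 0)"
      unfolding c_def by (intro tendsto_exp filterlim_compose[OF U_bot ln_at_0])
    moreover have "\<forall>\<^sub>F s in at_right 0. C s = c s"
      using C_eq by (auto simp: eventually_at_filter)
    ultimately show ?thesis using \<alpha> by (simp add: tendsto_cong exp_minus divide_inverse)
  qed
  have H_at_0: "(H \<longlongrightarrow> 0) (at_right 0)"
  proof (rule Lim_null_comparison)
    show "\<forall>\<^sub>F s in at_right 0. norm (H s) \<le> s / \<alpha>"
      using H_bound by (auto simp: eventually_at_filter)
    show "((\<lambda>s. s / \<alpha>) \<longlongrightarrow> 0) (at_right 0)"
      using \<alpha> by (auto intro!: tendsto_eq_intros)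
  qed

  have ode: "deriv (deriv C) s =
      (deriv C s)\<^sup>2 / C s - deriv C s / s + (C s)\<^sup>2 / s + \<alpha> / s\<^sup>2 - 1 / (s\<^sup>2 * C s)" if s: "s > 0" for s
    unfolding DERIV_imp_deriv[OF ddC[OF s]] deriv_C[OF s]
    using s c_pos[of s] by (simp add: C_eq[OF s] field_simps power2_eq_square)
  have H_formula: "H s = 1 / 4 * (s * deriv C s / C s)\<^sup>2 - s * C s / 2 - 1 / 4 * (1 / C s - \<alpha>)\<^sup>2" if s: "s > 0" for s
    unfolding H_eq[OF s] k_def deriv_C[OF s] C_eq[OF s] using s c_pos[of s] by simp
  have sigma: "(s * deriv (deriv H) s)\<^sup>2 + 4 * (deriv H s)\<^sup>2 * (s * deriv H s - H s)
      - (\<alpha> * deriv H s + 1 / 2)\<^sup>2 = 0" if s: "s > 0" for s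
  proof -
    have e1: "s * deriv (deriv H) s = - (c s * v s) / 2"
      using s by (simp add: DERIV_imp_deriv[OF ddH[OF s]] C_eq)
    have e2: "deriv H s = - c s / 2" using deriv_H[OF s] C_eq[OF s] by simp
    show ?thesis
      unfolding e1 e2 H_eq[OF s] k_def using c_pos[of s]
      by (simp add: field_simps power2_eq_square)
  qed
  have D_part: "\<forall>s\<ge>0. (\<lambda>n. hankel_det n (scaled_t s \<alpha> n) \<alpha> / hankel_det n 0 \<alpha>) \<longlonglongrightarrow> \<Delta> s"
    using D_conv D_eq by simp
  have C_part: "\<forall>s>0. (\<lambda>n. aux_y n (scaled_t s \<alpha> n) \<alpha> / scaled_t s \<alpha> n) \<longlonglongrightarrow> C s"
    using C_conv C_eq by simp
  have H_part: "\<forall>s\<ge>0. (\<lambda>n. log_deriv_H n (scaled_t s \<alpha> n) \<alpha>) \<longlonglongrightarrow> H s"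
    using H_lim by blast
  have D_0: "\<Delta> 0 = 1"
    using D_eq[of 0] by simp
  have C_ode: "\<forall>s>0. C differentiable (at s) \<and> deriv C differentiable (at s) \<and> C s \<noteq> 0 \<and>
        deriv (deriv C) s =
          (deriv C s)\<^sup>2 / C s - deriv C s / s + (C s)\<^sup>2 / s + \<alpha> / s\<^sup>2 - 1 / (s\<^sup>2 * C s)"
  proof (intro allI impI conjI)
    fix s :: real assume s: "s > 0"
    show "C differentiable (at s)" "deriv C differentiable (at s)"
      using dC[OF s] ddC[OF s] unfolding real_differentiable_def by blast+
    show "C s \<noteq> 0"
      using C_eq[OF s] c_pos[of s] by simp
  qed (rule ode)
  have D_deriv: "\<forall>s>0. \<Delta> s > 0 \<and> \<Delta> differentiable (at s) \<and> H s = s * deriv (\<lambda>u. ln (\<Delta> u)) s"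
  proof (intro allI impI conjI)
    fix s :: real assume s: "s > 0"
    show "\<Delta> s > 0" using D_eq s by simp
    show "\<Delta> differentiable (at s)" using dD[OF s] unfolding real_differentiable_def by blast
    show "H s = s * deriv (\<lambda>u. ln (\<Delta> u)) s" using s by (simp add: dlnD g_def)
  qed
  have H_ode: "\<forall>s>0. H differentiable (at s) \<and> deriv H differentiable (at s) \<and>
        (s * deriv (deriv H) s)\<^sup>2 + 4 * (deriv H s)\<^sup>2 * (s * deriv H s - H s)
          - (\<alpha> * deriv H s + 1 / 2)\<^sup>2 = 0"
  proof (intro allI impI conjI)
    fix s :: real assume s: "s > 0"
    show "H differentiable (at s)" "deriv H differentiable (at s)"
      using dH[OF s] ddH[OF s] unfolding real_differentiable_def by blast+
  qed (rule sigma)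
  have H_C: "\<forall>s>0. H s = 1 / 4 * (s * deriv C s / C s)\<^sup>2 - s * C s / 2 - 1 / 4 * (1 / C s - \<alpha>)\<^sup>2"
    using H_formula by blast
  show ?thesis
    by (intro conjI D_part C_part H_part D_0 D_at_0 C_ode C_at_0 D_deriv H_ode H_0 H_at_0 H_C)
qed

end
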